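(* Let $d\geq 2$ and let $G$ be the Green function of the complex projective space $\mathbb{P}(\mathbb{C}^{d+1})$ with the Fubini–Study metric. For $\omega_r=(x_1,\ldots,x_r)\in\mathbb{P}(\mathbb{C}^{d+1})^r$ let $\mathcal{E}_G(\omega_r)=\sum_{i\neq j}G(x_i,x_j)$. Then \[ \liminf_{r\to\infty}\frac{\min_{\omega_r}\mathcal{E}_{G}(\omega_{r})}{r^{2 - \frac{1}{d}}}\leq-\frac{ (d!)^{1 - \frac{1}{d}}}{4\pi^{d} (d-1)}, \] where the minimum is over all $\omega_r\in\mathbb{P}(\mathbb{C}^{d+1})^r$.
   Context: The Fubini–Study metric on $\mathbb{P}(\mathbb{C}^{d+1})$ is normalized so that the distance between $p,q$ satisfies $\sin d_{\mathbb{P}}(p,q)=\sqrt{1-\frac{|\langle p,q\rangle|^2}{\|p\|^2\|q\|^2}}$; with this metric the volume of $\mathbb{P}(\mathbb{C}^{d+1})$ is $\pi^d/d!$. The Green function $G:\mathbb{P}(\mathbb{C}^{d+1})\times\mathbb{P}(\mathbb{C}^{d+1})\to\mathbb{R}\cup\{+\infty\}$ is the symmetric function such that $G(x,\cdot)$ has zero mean (with respect to the Riemannian volume) for every $x$ and $\Delta_yG(x,y)=\delta_x(y)-\mathrm{Vol}(\mathbb{P}(\mathbb{C}^{d+1}))^{-1}$ in the distributional sense, where $\delta_x$ is the Dirac delta at $x$ and $\Delta$ is the Laplace–Beltrami operator with the sign convention for which $G(x,y)\to+\infty$ as $y\to x$. *)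

theory Defs
  imports "HOL-Analysis.Analysis" "HOL-Library.Extended_Real"
begin

text \<open>Model of the complex projective space P(C^(d+1)), with C^(d+1) = complex^'n,
  CARD('n) = d+1.  A point of P is represented by any nonzero vector; functions on P are
  functions on nonzero vectors that are invariant under nonzero complex scaling.
  The Fubini--Study metric is the one making the Hopf map from the unit sphere a
  Riemannian submersion (sin dist = sqrt(1 - |<p,q>|^2/(|p|^2|q|^2)), volume pi^d/d!).\<close>

definition proj_eq :: "complex^'n \<Rightarrow> complex^'n \<Rightarrow> bool" where
  "proj_eq x y \<longleftrightarrow> (\<exists>c::complex. y = c *s x)"

fun iter_deriv :: "(complex^'n) list \<Rightarrow> (complex^'n \<Rightarrow> real) \<Rightarrow> complex^'n \<Rightarrow> real" where
  "iter_deriv [] F = F"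
| "iter_deriv (b # bs) F = (\<lambda>x. frechet_derivative (iter_deriv bs F) (at x) b)"

definition smooth_on :: "(complex^'n) set \<Rightarrow> (complex^'n \<Rightarrow> real) \<Rightarrow> bool" where
  "smooth_on U F \<longleftrightarrow> (\<forall>bs. set bs \<subseteq> Basis \<longrightarrow> (\<forall>x\<in>U. iter_deriv bs F differentiable (at x)))"

definition eucl_laplacian :: "(complex^'n \<Rightarrow> real) \<Rightarrow> complex^'n \<Rightarrow> real" where
  "eucl_laplacian F x = (\<Sum>b\<in>Basis. iter_deriv [b, b] F x)"

text \<open>Smooth functions on P, lifted to degree-0 homogeneous functions on C^(d+1) - {0}.\<close>
definition FS_test :: "(complex^'n \<Rightarrow> real) \<Rightarrow> bool" where
  "FS_test \<phi> \<longleftrightarrow> smooth_on (- {0}) \<phi> \<and>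
     (\<forall>z (c::complex). z \<noteq> 0 \<and> c \<noteq> 0 \<longrightarrow> \<phi> (c *s z) = \<phi> z)"

text \<open>Laplace--Beltrami operator of the Fubini--Study metric (sign convention: positive
  operator, Delta = - div grad), on lifts: for degree-0 homogeneous F,
  (Delta_P f)(z) = - |z|^2 (Euclidean Laplacian of F)(z).\<close>
definition FS_laplacian :: "(complex^'n \<Rightarrow> real) \<Rightarrow> complex^'n \<Rightarrow> real" where
  "FS_laplacian F z = - ((norm z)^2 * eucl_laplacian F z)"

text \<open>Integration against the Fubini--Study Riemannian volume, for a degree-0 homogeneous
  lift F:  int_P f dV = (1/(pi * d!)) * int_{C^(d+1)} F(z) exp(-|z|^2) dz.\<close>
definition FS_integrable :: "(complex^'n \<Rightarrow> real) \<Rightarrow> bool" where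
  "FS_integrable F \<longleftrightarrow> integrable lborel (\<lambda>z. F z * exp (- ((norm z)^2)))"

definition FS_integral :: "(complex^'n \<Rightarrow> real) \<Rightarrow> real" where
  "FS_integral F = (\<integral>z. F z * exp (- ((norm z)^2)) \<partial>lborel) / (pi * fact (CARD('n) - 1))"

definition FS_volume :: "'n::finite itself \<Rightarrow> real" where
  "FS_volume _ = pi ^ (CARD('n) - 1) / fact (CARD('n) - 1)"

text \<open>G is the Green function of P(C^(d+1)): symmetric, well defined on P, +infinity exactly
  on the diagonal, real-valued and continuous off the diagonal, zero mean in the second
  variable, and Delta_y G(x,y) = delta_x - 1/Vol in the sense of distributions.\<close>
definition is_FS_green :: "(complex^'n \<Rightarrow> complex^'n \<Rightarrow> ereal) \<Rightarrow> bool" where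
  "is_FS_green G \<longleftrightarrow>
     (\<forall>x y. x \<noteq> 0 \<and> y \<noteq> 0 \<longrightarrow> G x y = G y x) \<and>
     (\<forall>x y (c::complex). x \<noteq> 0 \<and> y \<noteq> 0 \<and> c \<noteq> 0 \<longrightarrow> G (c *s x) y = G x y) \<and>
     (\<forall>x y. x \<noteq> 0 \<and> y \<noteq> 0 \<longrightarrow> (G x y = \<infinity> \<longleftrightarrow> proj_eq x y) \<and> G x y \<noteq> - \<infinity>) \<and>
     continuous_on {(x, y). x \<noteq> 0 \<and> y \<noteq> 0 \<and> \<not> proj_eq x y} (\<lambda>(x, y). real_of_ereal (G x y)) \<and>
     (\<forall>x. x \<noteq> 0 \<longrightarrow> FS_integrable (\<lambda>z. real_of_ereal (G x z)) \<and>
                     FS_integral (\<lambda>z. real_of_ereal (G x z)) = 0) \<and>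
     (\<forall>x \<phi>. x \<noteq> 0 \<and> FS_test \<phi> \<longrightarrow>
        FS_integral (\<lambda>z. real_of_ereal (G x z) * FS_laplacian \<phi> z)
          = \<phi> x - FS_integral \<phi> / FS_volume TYPE('n))"

definition green_energy :: "(complex^'n \<Rightarrow> complex^'n \<Rightarrow> ereal) \<Rightarrow> nat \<Rightarrow> (nat \<Rightarrow> complex^'n) \<Rightarrow> ereal" where
  "green_energy G r \<omega> = (\<Sum>i<r. \<Sum>j<r. if i = j then 0 else G (\<omega> i) (\<omega> j))"

definition min_green_energy :: "(complex^'n \<Rightarrow> complex^'n \<Rightarrow> ereal) \<Rightarrow> nat \<Rightarrow> ereal" where
  "min_green_energy G r = (INF \<omega> \<in> {\<omega>. \<forall>i<r. \<omega> i \<noteq> 0}. green_energy G r \<omega>)"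

end

theory Submission
  imports Defs "HOL-Probability.Distributions" "HOL-Computational_Algebra.Polynomial"
    "HOL-Real_Asymp.Real_Asymp"
begin

text \<open>The minimal energy is bounded by the mean energy of the projective ensemble, the determinantal
  process on \<open>P(C\<^bsup>d+1\<^esup>)\<close> with kernel \<open>r (\<langle>x, z\<rangle> / (|x| |z|))\<^bsup>L\<^esup>\<close> with respect to the normalized volume,
  which has \<open>r = binomial (d + L) L\<close> points. Since \<open>G(x, \<cdot>)\<close> has mean zero, this mean is
  \<open>- r\<^sup>2\<close> times the average over \<open>z\<close> of \<open>G(x, z) t(x, z)\<^bsup>L\<^esup>\<close>, where \<open>t(x, z)\<close> is the squared cosine
  of the distance. The Green function enters only through its defining equation tested against
  \<open>t(y, \<cdot>)\<^bsup>k\<^esup>\<close>: as the Laplacian sends \<open>t\<^bsup>k\<^esup>\<close> to \<open>4 k (k + d) t\<^bsup>k\<^esup> - 4 k\<^sup>2 t\<^bsup>k-1\<^esup>\<close>, the averages of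
  \<open>G(x, \<cdot>) t(y, \<cdot>)\<^bsup>k\<^esup>\<close> satisfy a recursion in \<open>k\<close>, whose solution grows like \<open>L\<^bsup>d-1\<^esup>\<close>.
  The same recursion bounds \<open>G\<close> from below, and together with the zero mean this makes \<open>G\<close> integrable
  in both variables jointly, as is needed to exchange the order of integration.\<close>

section \<open>Determinantal processes\<close>

text \<open>The determinantal process itself is never constructed. All that is used of it is that a
  number below the energy of every admissible configuration is below the integral of the energy
  against the two-point density, and this is proved by induction on the rank. An external field
  \<open>f\<close> is carried along, because fixing one point turns its interaction with the other
  points into such a field. Configurations with coinciding points have to be excluded throughout:
  their energy is infinite, whereas the real-valued substitute \<open>g\<close> is 0 there.

  Origin of the constant: at distance 0 the recursion yields a sum of terms binomial(d + j, j) / (4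
  j (j + d)), about j^(d-2) / (4 d!), hence about L^(d-1) / (4 (d-1) d!) in total; this growth is
  where d >= 2 enters. The energy is at most -(r / Vol) times this sum up to a bounded error in the
  sum. Since r is about L^d / d!, the power r^(1 - 1/d) is about L^(d-1) / (d!)^(1 - 1/d), and Vol =
  pi^d / d! turns the quotient into the stated bound.\<close>

lemma integrable_mult_bounded:
  fixes f :: "'a \<Rightarrow> 'b::{real_normed_algebra, banach, second_countable_topology}"
  assumes "integrable M f" "g \<in> borel_measurable M" "\<And>x. norm (g x) \<le> B"
  shows "integrable M (\<lambda>x. f x * g x)"
proof (rule Bochner_Integration.integrable_bound)
  show "integrable M (\<lambda>x. B * norm (f x))"
    using assms(1) by simp
  show "(\<lambda>x. f x * g x) \<in> borel_measurable M"
    using assms(1,2) by measurable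
  have "norm (f x * g x) \<le> norm (B * norm (f x))" for x
  proof -
    have "norm (f x * g x) \<le> norm (f x) * B"
      by (rule order_trans[OF norm_mult_ineq mult_left_mono[OF assms(3)]]) simp
    also have "\<dots> \<le> norm (B * norm (f x))" by (simp add: mult.commute)
    finally show ?thesis .
  qed
  then show "AE x in M. norm (f x * g x) \<le> norm (B * norm (f x))" by simp
qed

text \<open>Integral kernel of an orthogonal projection of rank \<open>r\<close> on
  L^2(\<open>M\<close>): self-adjoint, idempotent, with trace \<open>r\<close>. The reproducing
  identity is required at every point, not almost everywhere, so that the kernel can be conditioned
  on a single point; boundedness settles integrability on a probability space.\<close>

definition projection_kernel :: "'a measure \<Rightarrow> nat \<Rightarrow> ('a \<Rightarrow> 'a \<Rightarrow> complex) \<Rightarrow> bool" where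
  "projection_kernel M r K \<longleftrightarrow>
     (\<lambda>(x, y). K x y) \<in> borel_measurable (M \<Otimes>\<^sub>M M) \<and>
     (\<exists>B. \<forall>x y. cmod (K x y) \<le> B) \<and>
     (\<forall>x y. K y x = cnj (K x y)) \<and>
     (\<forall>x\<in>space M. \<forall>z\<in>space M. (\<integral>y. K x y * K y z \<partial>M) = K x z) \<and>
     (\<integral>x. Re (K x x) \<partial>M) = real r"

text \<open>The determinants of \<open>K\<close> at two and at three points: up to normalization, the correlation
  functions of the determinantal process.\<close>

definition corr2 :: "('a \<Rightarrow> 'a \<Rightarrow> complex) \<Rightarrow> 'a \<Rightarrow> 'a \<Rightarrow> real" where
  "corr2 K x z = Re (K x x) * Re (K z z) - (cmod (K x z))\<^sup>2"

definition corr3 :: "('a \<Rightarrow> 'a \<Rightarrow> complex) \<Rightarrow> 'a \<Rightarrow> 'a \<Rightarrow> 'a \<Rightarrow> real" where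
  "corr3 K y x z = Re (K y y) * corr2 K x z - Re (K x x) * (cmod (K z y))\<^sup>2
     - Re (K z z) * (cmod (K x y))\<^sup>2 + 2 * Re (K x z * (K z y * K y x))"

text \<open>For \<open>K y y\<close> nonzero this is the kernel of the projection onto those
  functions in the range of \<open>K\<close> that vanish at \<open>y\<close>, the orthogonal
  complement of \<open>K\<close> in the direction of its section at \<open>y\<close>.\<close>

definition schur_complement :: "('a \<Rightarrow> 'a \<Rightarrow> complex) \<Rightarrow> 'a \<Rightarrow> 'a \<Rightarrow> 'a \<Rightarrow> complex" where
  "schur_complement K y x z = K x z - K x y * K y z / K y y"

context prob_space
begin

lemma projection_kernel_measurable:
  assumes "projection_kernel M r K" "f \<in> measurable N M" "g \<in> measurable N M"
  shows "(\<lambda>x. K (f x) (g x)) \<in> borel_measurable N"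
proof -
  have "(\<lambda>(x, y). K x y) \<circ> (\<lambda>x. (f x, g x)) \<in> borel_measurable N"
    using assms(1) unfolding projection_kernel_def
    by (intro measurable_comp[OF measurable_Pair[OF assms(2,3)]]) blast
  then show ?thesis by (simp add: comp_def)
qed

lemma projection_kernel_bound:
  assumes "projection_kernel M r K"
  obtains B where "B \<ge> 0" "\<And>x y. cmod (K x y) \<le> B"
  using assms unfolding projection_kernel_def by (meson norm_ge_zero order_trans)

lemma projection_kernel_cnj:
  "projection_kernel M r K \<Longrightarrow> K y x = cnj (K x y)"
  unfolding projection_kernel_def by blast

lemma projection_kernel_diag:
  "projection_kernel M r K \<Longrightarrow> K x x = of_real (Re (K x x))"
  using projection_kernel_cnj[of r K x x] by (simp add: complex_eq_iff)

lemma projection_kernel_cmod_cnj: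
  "projection_kernel M r K \<Longrightarrow> cmod (K y x) = cmod (K x y)"
  by (subst projection_kernel_cnj[of r K y x]) simp_all

lemma projection_kernel_mult_cnj:
  "projection_kernel M r K \<Longrightarrow> K x y * K y x = of_real ((cmod (K x y))\<^sup>2)"
  using complex_norm_square[of "K x y"] by (simp add: projection_kernel_cnj[of r K y x])

lemma projection_kernel_repro:
  "\<lbrakk>projection_kernel M r K; x \<in> space M; z \<in> space M\<rbrakk> \<Longrightarrow> (\<integral>y. K x y * K y z \<partial>M) = K x z"
  unfolding projection_kernel_def by blast

lemma projection_kernel_norm:
  assumes "projection_kernel M r K" "x \<in> space M"
  shows "(\<integral>y. (cmod (K x y))\<^sup>2 \<partial>M) = Re (K x x)"
proof -
  have "(\<integral>y. K x y * K y x \<partial>M) = of_real (\<integral>y. (cmod (K x y))\<^sup>2 \<partial>M)"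
    by (simp only: projection_kernel_mult_cnj[OF assms(1)] integral_complex_of_real)
  then show ?thesis
    using projection_kernel_repro[OF assms assms(2)] by (metis Re_complex_of_real)
qed

lemma projection_kernel_diag_nonneg:
  "\<lbrakk>projection_kernel M r K; x \<in> space M\<rbrakk> \<Longrightarrow> Re (K x x) \<ge> 0"
  by (subst projection_kernel_norm[symmetric]) auto

lemma projection_kernel_integrable_norm:
  assumes "projection_kernel M r K" "x \<in> space M"
  shows "integrable M (\<lambda>y. (cmod (K x y))\<^sup>2)"
proof -
  obtain B where "B \<ge> 0" and B: "\<And>x y. cmod (K x y) \<le> B" using projection_kernel_bound[OF assms(1)] by blast
  have [measurable]: "(\<lambda>y. K x y) \<in> borel_measurable M"
    by (rule projection_kernel_measurable[OF assms(1)]) (use assms(2) in auto)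
  show ?thesis
    by (rule integrable_const_bound[of _ "B\<^sup>2"]) (auto intro!: power_mono B)
qed

text \<open>The diagonal value is the squared L^2 norm of the row \<open>K x\<close>, so this row
  vanishes almost everywhere; the reproducing identity then makes it vanish everywhere.\<close>

lemma projection_kernel_zero:
  assumes "projection_kernel M r K" "Re (K x x) = 0" "x \<in> space M" "z \<in> space M"
  shows "K x z = 0"
proof -
  have "AE y in M. (cmod (K x y))\<^sup>2 = 0"
    using integral_nonneg_eq_0_iff_AE[OF projection_kernel_integrable_norm[OF assms(1,3)]]
      projection_kernel_norm[OF assms(1,3)] assms(2) by auto
  then have "(\<integral>y. K x y * K y z \<partial>M) = 0"
    by (intro integral_eq_zero_AE) auto
  then show ?thesis using projection_kernel_repro[OF assms(1,3,4)] by metis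
qed

text \<open>The factorization of a 3x3 determinant into a diagonal entry and the determinant of its
  Schur complement. It is what identifies conditioning on \<open>y\<close> with passing to the
  smaller kernel.\<close>

lemma corr2_schur_complement:
  assumes "projection_kernel M r K" "Re (K y y) \<noteq> 0"
  shows "Re (K y y) * corr2 (schur_complement K y) x z = corr3 K y x z"
proof -
  define k where "k = Re (K y y)"
  have k: "K y y = of_real k" "k \<noteq> 0"
    using projection_kernel_diag[OF assms(1)] assms(2) by (auto simp: k_def)
  have c: "K y x = cnj (K x y)" "K y z = cnj (K z y)"
    by (rule projection_kernel_cnj[OF assms(1)])+
  have S: "Re (schur_complement K y w w) = Re (K w w) - (cmod (K w y))\<^sup>2 / k" for w
    using projection_kernel_mult_cnj[OF assms(1), of w y]
    unfolding schur_complement_def k(1) by simp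
  have T: "(cmod (schur_complement K y x z))\<^sup>2 = (cmod (K x z))\<^sup>2 
      - 2 * Re (K x z * (K z y * K y x)) / k + (cmod (K x y))\<^sup>2 * (cmod (K z y))\<^sup>2 / k\<^sup>2"
  proof -
    have *: "(cmod (a - b * c / k))\<^sup>2 = (cmod a)\<^sup>2 - 2 * Re (a * (cnj c * cnj b)) / k
        + (cmod b)\<^sup>2 * (cmod c)\<^sup>2 / k\<^sup>2" for a b c :: complex
    proof -
      have "(cmod (a - u))\<^sup>2 = (cmod a)\<^sup>2 - 2 * Re (a * cnj u) + (cmod u)\<^sup>2" for u
        unfolding cmod_power2 by (simp add: power2_eq_square algebra_simps)
      from this[of "b * c / k"] show ?thesis
        by (simp add: norm_mult norm_divide power_mult_distrib power_divide mult_ac)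
    qed
    show ?thesis
      using *[of "K x z" "K x y" "K y z"]
      unfolding schur_complement_def k(1) c by simp
  qed
  have "k * ((X - a / k) * (Z - b / k) - (c - 2 * R / k + a * b / k\<^sup>2))
      = k * (X * Z - c) - X * b - Z * a + 2 * R" for X Z a b c R :: real
    using k(2) by (simp add: field_simps power2_eq_square)
  then show ?thesis
    unfolding corr2_def corr3_def S T k_def[symmetric] by blast
qed

text \<open>The trace drops by the integral of \<open>(cmod (K y x))\<^sup>2 / K y y\<close>, which
  is 1 by the reproducing identity; idempotence follows by expanding the product into four
  reproducing integrals.\<close>

lemma projection_kernel_schur_complement:
  assumes K: "projection_kernel M (Suc r) K" and y: "Re (K y y) \<noteq> 0" "y \<in> space M"
  shows "projection_kernel M r (schur_complement K y)"
proof -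
  obtain B where B: "B \<ge> 0" "\<And>x y. cmod (K x y) \<le> B" using projection_kernel_bound[OF K] by blast
  note [measurable (raw)] = projection_kernel_measurable[OF K]
  define k where "k = Re (K y y)"
  have k: "K y y = of_real k" "k \<noteq> 0"
    using projection_kernel_diag[OF K] y by (auto simp: k_def)
  have int: "integrable M (\<lambda>w. K x (f w) * K (g w) z)" if "f \<in> measurable M M" "g \<in> measurable M M" "x \<in> space M" "z \<in> space M" for f g x z
  proof (rule integrable_const_bound[of _ "B * B"])
    show "(\<lambda>w. K x (f w) * K (g w) z) \<in> borel_measurable M"
      using that by measurable
    show "AE w in M. cmod (K x (f w) * K (g w) z) \<le> B * B"
      by (auto simp: norm_mult intro!: mult_mono B)
  qed
  show ?thesis
    unfolding projection_kernel_def
  proof (intro conjI allI)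
    show "(\<lambda>(x, z). schur_complement K y x z) \<in> borel_measurable (M \<Otimes>\<^sub>M M)"
      unfolding schur_complement_def using y(2) by measurable
    have "cmod (schur_complement K y x z) \<le> B + B * B / \<bar>k\<bar>" for x z
      unfolding schur_complement_def k(1)
      by (rule order_trans[OF norm_triangle_ineq4])
         (auto simp: norm_mult norm_divide intro!: add_mono B divide_right_mono mult_mono)
    then show "\<exists>B. \<forall>x z. cmod (schur_complement K y x z) \<le> B" by blast
    show "schur_complement K y z x = cnj (schur_complement K y x z)" for x z
      unfolding schur_complement_def k(1)
      by (simp add: projection_kernel_cnj[OF K, of z x] projection_kernel_cnj[OF K, of y x]
            projection_kernel_cnj[OF K, of z y] projection_kernel_cnj[OF K, of y z, symmetric])
    show "\<forall>x\<in>space M. \<forall>z\<in>space M.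
      (\<integral>w. schur_complement K y x w * schur_complement K y w z \<partial>M) = schur_complement K y x z"
    proof (intro ballI)
      fix x z assume xz: "x \<in> space M" "z \<in> space M"
      have "(\<integral>w. schur_complement K y x w * schur_complement K y w z \<partial>M)
          = (\<integral>w. K x w * K w z - (K x w * K w y) * (K y z / k)
              - (K y w * K w z) * (K x y / k) + (K y w * K w y) * (K x y * K y z / k\<^sup>2) \<partial>M)"
        by (rule Bochner_Integration.integral_cong)
           (simp_all add: schur_complement_def k(1) algebra_simps power2_eq_square)
      also have "\<dots> = K x z - K x y * (K y z / k) - K y z * (K x y / k) + K y y * (K x y * K y z / k\<^sup>2)"
        using xz y int[of "\<lambda>w. w" "\<lambda>w. w"]
        by (simp add: projection_kernel_repro[OF K] del: times_divide_eq_right)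
      also have "\<dots> = schur_complement K y x z"
        using k(2) by (simp add: schur_complement_def k(1) field_simps power2_eq_square)
      finally show "(\<integral>w. schur_complement K y x w * schur_complement K y w z \<partial>M) = schur_complement K y x z" .
    qed
    have "Re (schur_complement K y x x) = Re (K x x) - (cmod (K y x))\<^sup>2 / k" for x
      using projection_kernel_mult_cnj[OF K, of y x]
      unfolding schur_complement_def k(1) by (simp add: mult.commute)
    moreover have "integrable M (\<lambda>x. Re (K x x))"
      by (rule integrable_const_bound[of _ B]) (auto intro: order_trans[OF abs_Re_le_cmod B(2)])
    moreover have "(\<integral>x. Re (K x x) \<partial>M) = real (Suc r)"
      using K unfolding projection_kernel_def by blast
    ultimately show "(\<integral>x. Re (schur_complement K y x x) \<partial>M) = real r"
      using projection_kernel_integrable_norm[OF K y(2)] projection_kernel_norm[OF K y(2)] k(2)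
      by (simp add: k_def)
  qed
qed

text \<open>Stated for a second space \<open>N\<close> so that it serves both the field
  (\<open>N\<close> equal to \<open>M\<close>) and the pair interaction (\<open>N\<close> the
  product of \<open>M\<close> with itself). Only the weight is bounded; \<open>f\<close> is merely
  integrable.\<close>

lemma weighted_Fubini:
  fixes f :: "'b \<Rightarrow> real" and w :: "'a \<Rightarrow> 'b \<Rightarrow> real"
  assumes N: "prob_space N" and f: "integrable N f"
    and w[measurable]: "(\<lambda>(y, p). w y p) \<in> borel_measurable (M \<Otimes>\<^sub>M N)"
    and B: "\<And>y p. \<bar>w y p\<bar> \<le> B"
  shows "integrable M (\<lambda>y. \<integral>p. f p * w y p \<partial>N)"
    and "(\<integral>y. (\<integral>p. f p * w y p \<partial>N) \<partial>M) = (\<integral>p. f p * (\<integral>y. w y p \<partial>M) \<partial>N)"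
proof -
  interpret N: prob_space N by (rule N)
  interpret P: pair_prob_space M N ..
  have [measurable]: "f \<in> borel_measurable N" using f by simp
  have "integrable (M \<Otimes>\<^sub>M N) (\<lambda>q. f (snd q))"
    by (rule P.Fubini_integrable) (use f in auto)
  then have int: "integrable (M \<Otimes>\<^sub>M N) (\<lambda>q. f (snd q) * w (fst q) (snd q))"
    by (rule integrable_mult_bounded[where B = B]) (auto simp: B split_beta')
  then show "integrable M (\<lambda>y. \<integral>p. f p * w y p \<partial>N)"
    using P.integrable_fst'[OF int] by simp
  have "(\<integral>p. (\<integral>y. f p * w y p \<partial>M) \<partial>N) = (\<integral>y. (\<integral>p. f p * w y p \<partial>N) \<partial>M)"
    by (rule P.Fubini_integral) (use int in \<open>simp add: split_beta'\<close>)
  then show "(\<integral>y. (\<integral>p. f p * w y p \<partial>N) \<partial>M) = (\<integral>p. f p * (\<integral>y. w y p \<partial>M) \<partial>N)"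
    by simp
qed

section \<open>Correlation functions with one point integrated out\<close>

lemma corr2_bounded:
  assumes K: "projection_kernel M r K"
  obtains B where "\<And>x z. \<bar>corr2 K x z\<bar> \<le> B" "\<And>y x z. \<bar>corr3 K y x z\<bar> \<le> B"
proof -
  obtain B where B: "B \<ge> 0" "\<And>x y. cmod (K x y) \<le> B"
    using projection_kernel_bound[OF K] by blast
  have R: "\<bar>Re (K x y)\<bar> \<le> B" for x y
    by (rule order_trans[OF abs_Re_le_cmod B(2)])
  have S: "\<bar>(cmod (K x y))\<^sup>2\<bar> \<le> B * B" for x y
    using power_mono[OF B(2), of x y 2] by (simp add: power2_eq_square)
  have S0: "(cmod (K x y))\<^sup>2 \<le> B * B" for x y
    using S[of x y] by simp
  have 2: "\<bar>corr2 K x z\<bar> \<le> B * B + B * B" for x z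
    unfolding corr2_def
    by (rule order_trans[OF abs_triangle_ineq4 add_mono])
       (auto simp: abs_mult S0 intro!: mult_mono R B)
  have T: "\<bar>Re (K x z * (K z y * K y x))\<bar> \<le> B * (B * B)" for x y z
    by (rule order_trans[OF abs_Re_le_cmod]) (auto simp: norm_mult intro!: mult_mono B)
  have 3: "\<bar>corr3 K y x z\<bar> \<le> B * (B * B + B * B) + B * (B * B) + B * (B * B) + 2 * (B * (B * B))" for y x z
  proof -
    have "\<bar>Re (K y y) * corr2 K x z\<bar> \<le> B * (B * B + B * B)"
      "\<bar>Re (K x x) * (cmod (K z y))\<^sup>2\<bar> \<le> B * (B * B)"
      "\<bar>Re (K z z) * (cmod (K x y))\<^sup>2\<bar> \<le> B * (B * B)"
      unfolding abs_mult by (intro mult_mono R 2 S; use B in simp)+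
    with T[of x z y] show ?thesis unfolding corr3_def by linarith
  qed
  show thesis
    using that[of "max (B * B + B * B) (B * (B * B + B * B) + B * (B * B) + B * (B * B) + 2 * (B * (B * B)))"] 2 3
    by (meson max.coboundedI1 max.coboundedI2)
qed

lemma integral_corr2:
  assumes K: "projection_kernel M r K" and z: "z \<in> space M"
  shows "(\<integral>y. corr2 K y z \<partial>M) = (real r - 1) * Re (K z z)"
proof -
  obtain B where B: "B \<ge> 0" "\<And>x y. cmod (K x y) \<le> B"
    using projection_kernel_bound[OF K] by blast
  note [measurable (raw)] = projection_kernel_measurable[OF K]
  have "integrable M (\<lambda>x. Re (K x x))"
    by (rule integrable_const_bound[of _ B]) (auto intro: order_trans[OF abs_Re_le_cmod B(2)])
  moreover have "(\<integral>x. Re (K x x) \<partial>M) = real r"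
    using K unfolding projection_kernel_def by blast
  ultimately show ?thesis
    unfolding corr2_def projection_kernel_cmod_cnj[OF K, of _ z]
    using projection_kernel_integrable_norm[OF K z] projection_kernel_norm[OF K z]
    by (simp add: algebra_simps)
qed

text \<open>The trace contributes \<open>r\<close> times \<open>corr2\<close>, each of the two
  squared-modulus terms removes \<open>Re (K x x) * Re (K z z)\<close>, and the cyclic term
  integrates to \<open>2 * (cmod (K x z))\<^sup>2\<close>; together the last three make up -2 times
  \<open>corr2\<close>.\<close>

lemma integral_corr3:
  assumes K: "projection_kernel M r K" and x: "x \<in> space M" and z: "z \<in> space M"
  shows "(\<integral>y. corr3 K y x z \<partial>M) = (real r - 2) * corr2 K x z"
proof -
  obtain B where B: "B \<ge> 0" "\<And>x y. cmod (K x y) \<le> B"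
    using projection_kernel_bound[OF K] by blast
  note [measurable (raw)] = projection_kernel_measurable[OF K]
  have 1: "integrable M (\<lambda>x. Re (K x x))"
    by (rule integrable_const_bound[of _ B]) (auto intro: order_trans[OF abs_Re_le_cmod B(2)])
  have 2: "(\<integral>x. Re (K x x) \<partial>M) = real r"
    using K unfolding projection_kernel_def by blast
  have 3: "integrable M (\<lambda>y. K x z * (K z y * K y x))"
    by (rule integrable_const_bound[of _ "B * (B * B)"])
       (use x z in \<open>auto simp: norm_mult intro!: mult_mono B\<close>)
  have 4: "(\<integral>y. Re (K x z * (K z y * K y x)) \<partial>M) = (cmod (K x z))\<^sup>2"
  proof -
    have "(\<integral>y. Re (K x z * (K z y * K y x)) \<partial>M) = Re (\<integral>y. K x z * (K z y * K y x) \<partial>M)"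
      by (rule integral_Re[OF 3])
    also have "\<dots> = Re (K x z * K z x)"
      by (simp add: projection_kernel_repro[OF K z x])
    finally show ?thesis by (simp add: projection_kernel_mult_cnj[OF K])
  qed
  have "integrable M (\<lambda>y. Re (K x z * (K z y * K y x)))" using 3 by (rule integrable_Re)
  then have "(\<integral>y. corr3 K y x z \<partial>M) = real r * corr2 K x z - Re (K x x) * Re (K z z)
      - Re (K z z) * Re (K x x) + 2 * (cmod (K x z))\<^sup>2"
    unfolding corr3_def
    using 1 2 4 projection_kernel_integrable_norm[OF K x] projection_kernel_norm[OF K x]
      projection_kernel_integrable_norm[OF K z] projection_kernel_norm[OF K z]
    by (simp del: times_complex.sel)
  then show ?thesis by (simp add: corr2_def algebra_simps)
qed

text \<open>Conditioning on one point \<open>y\<close> of the determinantal process with kernel \<open>K\<close>, chosen with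
  density proportional to \<open>K y y\<close>, leaves the determinantal process of the Schur complement,
  whose rank is smaller by one.\<close>

lemma determinantal_mean_bound:
  fixes F :: "'a \<Rightarrow> 'a \<Rightarrow> real"
  assumes F: "integrable (M \<Otimes>\<^sub>M M) (\<lambda>(x, z). F x z)" and sym: "\<And>x z. F x z = F z x"
    and good: "\<And>x. x \<in> space M \<Longrightarrow> AE z in M. good x z"
  shows "\<lbrakk>projection_kernel M r K; integrable M f; AE x in M. x \<in> A;
      \<And>y. \<lbrakk>\<And>i. i < r \<Longrightarrow> y i \<in> A; \<And>i j. i < j \<Longrightarrow> j < r \<Longrightarrow> good (y i) (y j)\<rbrakk> \<Longrightarrow>
        m \<le> (\<Sum>i<r. f (y i)) + (\<Sum>i<r. \<Sum>j<r. if i = j then 0 else F (y i) (y j))\<rbrakk>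
    \<Longrightarrow> m \<le> (\<integral>x. f x * Re (K x x) \<partial>M) + (\<integral>p. F (fst p) (snd p) * corr2 K (fst p) (snd p) \<partial>(M \<Otimes>\<^sub>M M))"
proof (induction r arbitrary: K f A m)
  case 0
  have K: "projection_kernel M 0 K" by fact
  note [measurable (raw)] = projection_kernel_measurable[OF K]
  obtain B where B: "B \<ge> 0" "\<And>x y. cmod (K x y) \<le> B"
    using projection_kernel_bound[OF K] by blast
  interpret P: pair_prob_space M M ..
  have i: "integrable M (\<lambda>x. Re (K x x))"
    by (rule integrable_const_bound[of _ B]) (auto intro: order_trans[OF abs_Re_le_cmod B(2)])
  have e: "(\<integral>x. Re (K x x) \<partial>M) = real 0"
    using K unfolding projection_kernel_def by blast
  have n: "AE x in M. 0 \<le> Re (K x x)"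
    using projection_kernel_diag_nonneg[OF K] by auto
  \<comment> \<open>A kernel of trace 0 has an almost everywhere vanishing diagonal, so both
    integrals vanish, and the hypothesis on the empty configuration reads
    \<open>m \<le> 0\<close>.\<close>
  have Z: "AE x in M. Re (K x x) = 0"
    using integral_nonneg_eq_0_iff_AE[OF i n] e by simp
  have "AE p in M \<Otimes>\<^sub>M M. corr2 K (fst p) (snd p) = 0"
  proof (rule P.AE_pair_measure)
    show "{x \<in> space (M \<Otimes>\<^sub>M M). corr2 K (fst x) (snd x) = 0} \<in> sets (M \<Otimes>\<^sub>M M)"
      unfolding corr2_def by measurable
    show "AE x in M. AE y in M. corr2 K (fst (x, y)) (snd (x, y)) = 0"
      using Z AE_space by eventually_elim
        (auto simp: corr2_def projection_kernel_zero[OF K])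
  qed
  then have "(\<integral>p. F (fst p) (snd p) * corr2 K (fst p) (snd p) \<partial>(M \<Otimes>\<^sub>M M)) = 0"
    by (intro integral_eq_zero_AE) auto
  moreover have "(\<integral>x. f x * Re (K x x) \<partial>M) = 0"
    using Z by (intro integral_eq_zero_AE) auto
  ultimately show ?case using "0.prems"(4) by simp
next
  case (Suc r)
  have K: "projection_kernel M (Suc r) K" and f: "integrable M f" by fact+
  note [measurable (raw)] = projection_kernel_measurable[OF K]
  interpret P: pair_prob_space M M ..
  have [measurable]: "f \<in> borel_measurable M" using f by simp
  have [measurable]: "(\<lambda>(x, z). F x z) \<in> borel_measurable (M \<Otimes>\<^sub>M M)" using F by simp
  obtain B0 where B0: "B0 \<ge> 0" "\<And>x y. cmod (K x y) \<le> B0"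
    using projection_kernel_bound[OF K] by blast
  obtain B where B: "\<And>x z. \<bar>corr2 K x z\<bar> \<le> B" "\<And>y x z. \<bar>corr3 K y x z\<bar> \<le> B"
    using corr2_bounded[OF K] by blast
  have [measurable]: "(\<lambda>(y, z). corr2 K y z) \<in> borel_measurable (M \<Otimes>\<^sub>M M)"
    "(\<lambda>(y, p). corr3 K y (fst p) (snd p)) \<in> borel_measurable (M \<Otimes>\<^sub>M (M \<Otimes>\<^sub>M M))"
    unfolding corr3_def corr2_def by measurable
  define I where "I = (\<integral>p. F (fst p) (snd p) * corr2 K (fst p) (snd p) \<partial>(M \<Otimes>\<^sub>M M))"
  define J where "J = (\<integral>x. f x * Re (K x x) \<partial>M)"
  define T1 where "T1 y = (\<integral>z. f z * corr2 K y z \<partial>M)" for y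
  define T2 where "T2 y = (\<integral>z. F y z * corr2 K y z \<partial>M)" for y
  define T3 where "T3 y = (\<integral>p. F (fst p) (snd p) * corr3 K y (fst p) (snd p) \<partial>(M \<Otimes>\<^sub>M M))" for y
  have F': "integrable (M \<Otimes>\<^sub>M M) (\<lambda>p. F (fst p) (snd p))" using F by (simp add: split_beta')
  have RK: "\<bar>Re (K x y)\<bar> \<le> B0" for x y
    by (rule order_trans[OF abs_Re_le_cmod B0(2)])
  \<comment> \<open>The conditional inequality for first point \<open>y\<close>, multiplied by its
    unnormalized density \<open>Re (K y y)\<close>. In this form it also holds where the density is
    0, all terms being 0 there.\<close>
  have pointwise: "AE y in M. Re (K y y) * m \<le> f y * Re (K y y) + T1 y + 2 * T2 y + T3 y"
    using Suc.prems(3) AE_space P.AE_integrable_fst'[OF F']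
  proof eventually_elim
    case (elim y)
    show ?case
    proof (cases "Re (K y y) = 0")
      case True
      have "corr2 K y z = 0" if "z \<in> space M" for z
        using that elim True by (simp add: corr2_def projection_kernel_zero[OF K])
      moreover have "corr3 K y x z = 0" if "x \<in> space M" "z \<in> space M" for x z
        using that elim True projection_kernel_cmod_cnj[OF K, of z y] projection_kernel_cmod_cnj[OF K, of x y]
        by (simp add: corr3_def projection_kernel_zero[OF K])
      ultimately have "T1 y = 0" "T2 y = 0" "T3 y = 0"
        unfolding T1_def T2_def T3_def
        by (auto intro!: integral_eq_zero_AE simp: space_pair_measure)
      then show ?thesis using True by simp
    next
      case False
      define K' where "K' = schur_complement K y"
      define k where "k = Re (K y y)"
      have k: "k > 0" using False projection_kernel_diag_nonneg[OF K] elim unfolding k_def by force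
      have K': "projection_kernel M r K'"
        unfolding K'_def by (rule projection_kernel_schur_complement[OF K False]) (use elim in auto)
      have k2: "k * Re (K' z z) = corr2 K y z" for z
      proof -
        have "K z y * K y z / K y y = of_real ((cmod (K z y))\<^sup>2 / k)"
          using projection_kernel_mult_cnj[OF K, of z y] projection_kernel_diag[OF K, of y]
          unfolding k_def by (metis of_real_divide)
        then have "Re (K' z z) = Re (K z z) - (cmod (K z y))\<^sup>2 / k"
          unfolding K'_def schur_complement_def by (metis Re_complex_of_real minus_complex.sel(1))
        then show ?thesis
          using k projection_kernel_cmod_cnj[OF K, of z y]
          unfolding corr2_def k_def[symmetric] by (simp add: field_simps)
      qed
      have k3: "k * corr2 K' x z = corr3 K y x z" for x z
        unfolding K'_def k_def by (rule corr2_schur_complement[OF K False])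
      have Fy: "integrable M (\<lambda>z. F y z)" using elim by simp
      \<comment> \<open>The factor 2 arises because the energy runs over ordered pairs, so each pair
        containing \<open>y\<close> occurs twice.\<close>
      have f': "integrable M (\<lambda>x. f x + 2 * F y x)" using f Fy by simp
      have A': "AE x in M. x \<in> {z \<in> A. good y z}"
        using Suc.prems(3) good[of y] elim by auto
      have "m - f y \<le> (\<integral>x. (f x + 2 * F y x) * Re (K' x x) \<partial>M)
          + (\<integral>p. F (fst p) (snd p) * corr2 K' (fst p) (snd p) \<partial>(M \<Otimes>\<^sub>M M))"
      proof (rule Suc.IH[OF K' f' A'])
        fix w assume w: "\<And>i. i < r \<Longrightarrow> w i \<in> {z \<in> A. good y z}"
          "\<And>i j. i < j \<Longrightarrow> j < r \<Longrightarrow> good (w i) (w j)"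
        \<comment> \<open>The fixed point \<open>y\<close> becomes the point of index 0 and the
          remaining configuration is shifted by one.\<close>
        define v where "v = case_nat y w"
        have v: "v 0 = y" "\<And>i. v (Suc i) = w i" by (simp_all add: v_def)
        have "m \<le> (\<Sum>i<Suc r. f (v i)) + (\<Sum>i<Suc r. \<Sum>j<Suc r. if i = j then 0 else F (v i) (v j))"
        proof (rule Suc.prems(4))
          show "v i \<in> A" if "i < Suc r" for i
            using that w(1) elim by (cases i) (auto simp: v)
          show "good (v i) (v j)" if "i < j" "j < Suc r" for i j
            using that w by (cases i; cases j) (auto simp: v)
        qed
        moreover have "(if Suc i = Suc j then 0 else F (v (Suc i)) (v (Suc j)))
            = (if i = j then 0 else F (w i) (w j))" for i j
          unfolding v by simp
        then have "(\<Sum>i<Suc r. \<Sum>j<Suc r. if i = j then 0 else F (v i) (v j))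
            = (\<Sum>j<r. F y (w j)) + ((\<Sum>i<r. F (w i) y) + (\<Sum>i<r. \<Sum>j<r. if i = j then 0 else F (w i) (w j)))"
          unfolding sum.lessThan_Suc_shift by (simp add: v sum.distrib)
        moreover have "(\<Sum>i<r. F (w i) y) = (\<Sum>j<r. F y (w j))"
          by (simp add: sym[of _ y])
        moreover have "(\<Sum>i<Suc r. f (v i)) = f y + (\<Sum>i<r. f (w i))"
          unfolding sum.lessThan_Suc_shift v ..
        ultimately show "m - f y \<le> (\<Sum>i<r. f (w i) + 2 * F y (w i))
            + (\<Sum>i<r. \<Sum>j<r. if i = j then 0 else F (w i) (w j))"
          by (simp add: sum.distrib sum_distrib_left[symmetric])
      qed
      then have "k * (m - f y) \<le> k * ((\<integral>x. (f x + 2 * F y x) * Re (K' x x) \<partial>M)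
          + (\<integral>p. F (fst p) (snd p) * corr2 K' (fst p) (snd p) \<partial>(M \<Otimes>\<^sub>M M)))"
        using k by (intro mult_left_mono) auto
      also have "\<dots> = (\<integral>x. k * ((f x + 2 * F y x) * Re (K' x x)) \<partial>M)
          + (\<integral>p. k * (F (fst p) (snd p) * corr2 K' (fst p) (snd p)) \<partial>(M \<Otimes>\<^sub>M M))"
        by (simp add: distrib_left)
      also have "(\<integral>x. k * ((f x + 2 * F y x) * Re (K' x x)) \<partial>M)
          = (\<integral>x. f x * corr2 K y x + 2 * (F y x * corr2 K y x) \<partial>M)"
        unfolding k2[symmetric] by (intro Bochner_Integration.integral_cong) (auto simp: algebra_simps)
      also have "\<dots> = T1 y + 2 * T2 y"
      proof -
        have [measurable]: "(\<lambda>x. corr2 K y x) \<in> borel_measurable M"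
          using elim unfolding corr2_def by measurable
        show ?thesis
          unfolding T1_def T2_def
          using integrable_mult_bounded[OF f, of "\<lambda>x. corr2 K y x" B]
            integrable_mult_bounded[OF Fy, of "\<lambda>x. corr2 K y x" B] B(1) by simp
      qed
      also have "(\<integral>p. k * (F (fst p) (snd p) * corr2 K' (fst p) (snd p)) \<partial>(M \<Otimes>\<^sub>M M)) = T3 y"
        unfolding k3[symmetric] T3_def by (intro Bochner_Integration.integral_cong) auto
      finally show ?thesis by (simp add: k_def algebra_simps)
    qed
  qed
  have i0: "integrable M (\<lambda>x. Re (K x x))"
    by (rule integrable_const_bound[of _ B0]) (auto intro: RK)
  have e0: "(\<integral>x. Re (K x x) \<partial>M) = real (Suc r)"
    using K unfolding projection_kernel_def by blast
  have iJ: "integrable M (\<lambda>y. f y * Re (K y y))"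
    by (rule integrable_mult_bounded[OF f, of _ B0]) (auto intro: RK)
  have T1: "integrable M T1" "(\<integral>y. T1 y \<partial>M) = real r * J"
  proof -
    note w = weighted_Fubini[OF prob_space_axioms f, of "corr2 K" B]
    show "integrable M T1" unfolding T1_def by (rule w) (use B in auto)
    have "(\<integral>y. T1 y \<partial>M) = (\<integral>z. f z * (\<integral>y. corr2 K y z \<partial>M) \<partial>M)"
      unfolding T1_def by (rule w) (use B in auto)
    also have "\<dots> = (\<integral>z. real r * (f z * Re (K z z)) \<partial>M)"
      by (intro Bochner_Integration.integral_cong) (auto simp: integral_corr2[OF K])
    finally show "(\<integral>y. T1 y \<partial>M) = real r * J" unfolding J_def by simp
  qed
  have T2: "integrable M T2" "(\<integral>y. T2 y \<partial>M) = I"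
  proof -
    have "integrable (M \<Otimes>\<^sub>M M) (\<lambda>p. F (fst p) (snd p) * corr2 K (fst p) (snd p))"
      by (rule integrable_mult_bounded[OF F', of _ B]) (auto simp: B)
    from P.integrable_fst'[OF this] P.integral_fst'[OF this]
    show "integrable M T2" "(\<integral>y. T2 y \<partial>M) = I" unfolding T2_def I_def by simp_all
  qed
  have T3: "integrable M T3" "(\<integral>y. T3 y \<partial>M) = (real r - 1) * I"
  proof -
    note w = weighted_Fubini[OF P.prob_space_axioms F', of "\<lambda>y p. corr3 K y (fst p) (snd p)" B]
    show "integrable M T3" unfolding T3_def by (rule w) (use B in auto)
    have "(\<integral>y. T3 y \<partial>M) = (\<integral>p. F (fst p) (snd p) * (\<integral>y. corr3 K y (fst p) (snd p) \<partial>M) \<partial>(M \<Otimes>\<^sub>M M))"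
      unfolding T3_def by (rule w) (use B in auto)
    also have "\<dots> = (\<integral>p. (real r - 1) * (F (fst p) (snd p) * corr2 K (fst p) (snd p)) \<partial>(M \<Otimes>\<^sub>M M))"
      by (intro Bochner_Integration.integral_cong)
         (auto simp: integral_corr3[OF K] space_pair_measure)
    finally show "(\<integral>y. T3 y \<partial>M) = (real r - 1) * I" unfolding I_def by simp
  qed
  \<comment> \<open>Integrating over \<open>y\<close>: the field terms give
    \<open>J + r * J\<close>, the pair terms \<open>2 * I + (r - 1) * I\<close>, so both carry the
    factor \<open>Suc r\<close>, which is also the mass of the density on the left.\<close>
  have "(\<integral>y. Re (K y y) * m \<partial>M) \<le> (\<integral>y. f y * Re (K y y) + T1 y + 2 * T2 y + T3 y \<partial>M)"
    by (rule integral_mono_AE) (use i0 iJ T1 T2 T3 pointwise in auto)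
  also have "\<dots> = real (Suc r) * (J + I)"
    using iJ T1 T2 T3 by (simp add: J_def[symmetric] algebra_simps)
  finally have "real (Suc r) * m \<le> real (Suc r) * (J + I)" using e0 by simp
  then show ?case unfolding I_def J_def by (simp del: of_nat_Suc)
qed

end

section \<open>Hermitian geometry and the Gaussian model of the Fubini--Study volume\<close>

definition herm :: "complex^'n \<Rightarrow> complex^'n \<Rightarrow> complex" where
  "herm x y = (\<Sum>j\<in>UNIV. x $ j * cnj (y $ j))"

lemma herm_add_left: "herm (x + y) z = herm x z + herm y z"
  and herm_add_right: "herm z (x + y) = herm z x + herm z y"
  and herm_scale_left: "herm (c *s x) y = c * herm x y"
  and herm_scale_right: "herm x (c *s y) = cnj c * herm x y"
  and herm_zero_left [simp]: "herm 0 y = 0"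
  and herm_zero_right [simp]: "herm y 0 = 0"
  by (simp_all add: herm_def sum.distrib sum_distrib_left algebra_simps)

lemma herm_cnj: "herm y x = cnj (herm x y)"
  by (simp add: herm_def mult.commute)

lemma cmod_herm_commute: "cmod (herm y x) = cmod (herm x y)"
  by (subst herm_cnj) simp

lemma Re_herm: "Re (herm x y) = x \<bullet> y"
  by (simp add: herm_def inner_vec_def inner_complex_def)

lemma Im_herm: "Im (herm x y) = x \<bullet> (\<i> *s y)"
  by (simp add: herm_def inner_vec_def inner_complex_def algebra_simps)

lemma herm_self: "herm x x = of_real ((norm x)\<^sup>2)"
proof -
  have "Im (herm x x) = 0"
    by (simp add: herm_def)
  then show ?thesis
    by (simp add: complex_eq_iff Re_herm power2_norm_eq_inner)
qed

lemma cmod_herm_sq: "(cmod (herm x y))\<^sup>2 = (x \<bullet> y)\<^sup>2 + (x \<bullet> (\<i> *s y))\<^sup>2"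
  by (simp add: cmod_power2 Re_herm Im_herm)

lemma norm_vector_scalar_mult: "norm (c *s x) = cmod c * norm (x :: complex^'n)"
  by (simp add: norm_vec_def L2_set_def norm_mult power_mult_distrib sum_distrib_left[symmetric] real_sqrt_mult)

lemma scaleR_eq_vector_scalar_mult: "r *\<^sub>R (x :: complex^'n) = of_real r *s x"
  by (simp add: vec_eq_iff complex_eq_iff)

lemma inner_imaginary: "(\<i> *s x) \<bullet> (\<i> *s y) = x \<bullet> (y :: complex^'n)" 
  "x \<bullet> (\<i> *s x) = 0"
  by (simp_all add: inner_vec_def inner_complex_def algebra_simps)

lemma measurable_herm [measurable]: "(\<lambda>(x, y). herm x y) \<in> borel_measurable (borel \<Otimes>\<^sub>M borel)"
proof -
  have "continuous_on UNIV (\<lambda>p. herm (fst p) (snd p))"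
    unfolding herm_def by (intro continuous_intros)
  then show ?thesis
    using borel_measurable_continuous_onI by (simp add: split_beta' borel_prod)
qed

text \<open>Pythagoras for the complex line through \<open>x\<close>. It is the common source of the
  Cauchy-Schwarz inequality, of its equality case, of the isometry of \<open>phase_map\<close>, and
  of the distance estimate behind the lower bound for \<open>g\<close>.\<close>

lemma norm_sub_projection:
  assumes "x \<noteq> 0"
  shows "(norm (y - (herm y x / (norm x)\<^sup>2) *s x))\<^sup>2 = (norm y)\<^sup>2 - (cmod (herm y x))\<^sup>2 / (norm x)\<^sup>2"
proof -
  define c where "c = herm y x / (norm x)\<^sup>2"
  have c: "herm y x = c * (norm x)\<^sup>2" using assms by (simp add: c_def)
  have "y \<bullet> (c *s x) = Re (herm y (c *s x))" by (simp add: Re_herm)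
  also have "\<dots> = Re (cnj c * (c * (norm x)\<^sup>2))" by (simp only: herm_scale_right c)
  also have "\<dots> = (cmod c)\<^sup>2 * (norm x)\<^sup>2"
    unfolding cmod_power2 by (simp add: power2_eq_square algebra_simps)
  finally have "y \<bullet> (c *s x) = (cmod c)\<^sup>2 * (norm x)\<^sup>2" .
  moreover have "(norm (y - c *s x))\<^sup>2 = (norm y)\<^sup>2 - 2 * (y \<bullet> (c *s x)) + (norm (c *s x))\<^sup>2"
    by (simp add: power2_norm_eq_inner inner_diff inner_commute)
  ultimately show ?thesis
    using assms unfolding c_def[symmetric]
    by (simp add: c norm_vector_scalar_mult norm_mult power_mult_distrib power2_eq_square)
qed

lemma cmod_herm_le: "cmod (herm x y) \<le> norm x * norm y"
proof (cases "y = 0")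
  case False
  have "(cmod (herm x y))\<^sup>2 / (norm y)\<^sup>2 \<le> (norm x)\<^sup>2"
    using norm_sub_projection[OF False, of x] zero_le_power2[of "norm (x - (herm x y / (norm y)\<^sup>2) *s y)"]
    by linarith
  then have "(cmod (herm x y))\<^sup>2 \<le> (norm x * norm y)\<^sup>2"
    using False by (simp add: field_simps power_mult_distrib)
  then show ?thesis by (rule power2_le_imp_le) simp
qed simp

text \<open>The equality case of Cauchy-Schwarz. In this form the relation is visibly closed,
  symmetric and invariant under scaling of nonzero vectors.\<close>

lemma proj_eq_iff:
  assumes "x \<noteq> 0" "y \<noteq> 0"
  shows "proj_eq x y \<longleftrightarrow> (cmod (herm x y))\<^sup>2 = (norm x)\<^sup>2 * (norm y)\<^sup>2"
proof
  assume "proj_eq x y"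
  then obtain c where "y = c *s x" unfolding proj_eq_def by blast
  then show "(cmod (herm x y))\<^sup>2 = (norm x)\<^sup>2 * (norm y)\<^sup>2"
    by (simp add: herm_scale_right herm_self norm_mult norm_vector_scalar_mult power_mult_distrib power2_eq_square)
next
  assume "(cmod (herm x y))\<^sup>2 = (norm x)\<^sup>2 * (norm y)\<^sup>2"
  then have "(norm (y - (herm y x / (norm x)\<^sup>2) *s x))\<^sup>2 = 0"
    using assms unfolding norm_sub_projection[OF assms(1)] by (simp add: cmod_herm_commute[of y x])
  then have "y = (herm y x / (norm x)\<^sup>2) *s x"
    unfolding zero_eq_power2 norm_eq_zero by (simp only: right_minus_eq)
  then show "proj_eq x y" unfolding proj_eq_def by blast
qed

section \<open>Orthogonal invariance of Lebesgue measure\<close>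

lemma nn_integral_lborel_translate:
  fixes a :: "'a::euclidean_space"
  assumes [measurable]: "g \<in> borel_measurable borel"
  shows "(\<integral>\<^sup>+x. g (a + x) \<partial>lborel) = (\<integral>\<^sup>+x. g x \<partial>lborel)"
  by (subst lborel_distr_plus[of a, symmetric]) (simp add: nn_integral_distr)

text \<open>The usual uniqueness argument for Haar measure, tested against the indicator function of the
  unit ball, which is invariant under isometries.\<close>

lemma lborel_distr_orthogonal:
  fixes T :: "'a::euclidean_space \<Rightarrow> 'a"
  assumes T: "orthogonal_transformation T"
  shows "distr lborel borel T = lborel"
proof (rule measure_eqI)
  fix A assume "A \<in> sets (distr lborel borel T)"
  then have [measurable]: "A \<in> sets borel" by simp
  have lin: "linear T" and nT: "\<And>x. norm (T x) = norm x"
    using T by (auto simp: orthogonal_transformation)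
  have [measurable]: "T \<in> borel_measurable borel"
    by (rule borel_measurable_continuous_onI[OF linear_continuous_on])
       (simp add: lin linear_conv_bounded_linear[symmetric])
  define S where "S = inv T"
  have TS: "T (S y) = y" for y
    unfolding S_def using orthogonal_transformation_surj[OF T] by (simp add: surj_f_inv_f)
  define C where "C = emeasure lborel (ball (0::'a) 1)"
  have ind[measurable]: "(indicator (ball 0 1) :: 'a \<Rightarrow> ennreal) \<in> borel_measurable borel"
    by (rule borel_measurable_indicator) simp
  have Cball: "(\<integral>\<^sup>+x. indicator (ball 0 1) (y - T x) \<partial>lborel) = C" for y
  proof -
    have "norm (y - T x) = norm (- S y + x)" for x
    proof -
      have "y - T x = T (S y - x)" by (simp add: linear_diff[OF lin] TS)
      then show ?thesis by (simp add: nT norm_minus_commute)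
    qed
    then have "(\<integral>\<^sup>+x. indicator (ball 0 1) (y - T x) \<partial>lborel)
        = (\<integral>\<^sup>+x. indicator (ball 0 1) (- S y + x) \<partial>lborel)"
      by (intro nn_integral_cong) (simp add: indicator_def)
    also have "\<dots> = C"
      by (subst nn_integral_lborel_translate[OF ind]) (simp add: C_def)
    finally show ?thesis .
  qed
  have "emeasure (distr lborel borel T) A * C = (\<integral>\<^sup>+x. indicator A (T x) \<partial>lborel) * C"
    by (simp add: emeasure_distr nn_integral_distr flip: nn_integral_indicator)
  also have "\<dots> = (\<integral>\<^sup>+(y::'a). (\<integral>\<^sup>+x. indicator A (T x) * indicator (ball 0 1) y \<partial>lborel) \<partial>lborel)"
    by (simp add: nn_integral_multc nn_integral_cmult_indicator C_def)
  \<comment> \<open>Since \<open>y = T (S y)\<close>, translating \<open>x\<close> by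
    \<open>S y\<close> adds \<open>y\<close> inside the indicator of \<open>A\<close>.\<close>
  also have "\<dots> = (\<integral>\<^sup>+y. (\<integral>\<^sup>+x. indicator A (T x + y) * indicator (ball 0 1) y \<partial>lborel) \<partial>lborel)"
  proof (rule nn_integral_cong)
    fix y
    have "(\<integral>\<^sup>+x. indicator A (T x) * indicator (ball 0 1) y \<partial>lborel)
        = (\<integral>\<^sup>+x. indicator A (T (S y + x)) * indicator (ball 0 1) y \<partial>lborel)"
      by (subst nn_integral_lborel_translate[of "\<lambda>x. indicator A (T x) * indicator (ball 0 1) y"]) auto
    then show "(\<integral>\<^sup>+x. indicator A (T x) * indicator (ball 0 1) y \<partial>lborel)
        = (\<integral>\<^sup>+x. indicator A (T x + y) * indicator (ball 0 1) y \<partial>lborel)"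
      by (simp add: linear_add[OF lin] TS add.commute)
  qed
  also have "\<dots> = (\<integral>\<^sup>+x. (\<integral>\<^sup>+y. indicator A (T x + y) * indicator (ball 0 1) y \<partial>lborel) \<partial>lborel)"
  proof (rule lborel_pair.Fubini')
    have [measurable]: "(\<lambda>p. T (fst p) + snd p) \<in> (lborel \<Otimes>\<^sub>M lborel) \<rightarrow>\<^sub>M (borel :: 'a measure)"
      by measurable
    show "(\<lambda>(x, y). indicator A (T x + y) * indicator (ball 0 1) y :: ennreal)
        \<in> borel_measurable (lborel \<Otimes>\<^sub>M lborel)"
      unfolding split_beta'
      by (intro borel_measurable_times_ennreal measurable_compose[where N = borel, OF _ borel_measurable_indicator]) simp_all
  qed
  \<comment> \<open>Translating \<open>y\<close> by \<open>- T x\<close> frees \<open>A\<close> from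
    \<open>x\<close>; after the next exchange of integrals the inner one is the volume of a unit
    ball around \<open>S y\<close>, because \<open>T\<close> is an isometry.\<close>
  also have "\<dots> = (\<integral>\<^sup>+x. (\<integral>\<^sup>+y. indicator A y * indicator (ball 0 1) (y - T x) \<partial>lborel) \<partial>lborel)"
  proof (rule nn_integral_cong)
    fix x
    show "(\<integral>\<^sup>+y. indicator A (T x + y) * indicator (ball 0 1) y \<partial>lborel)
        = (\<integral>\<^sup>+y. indicator A y * indicator (ball 0 1) (y - T x) \<partial>lborel)"
      by (subst nn_integral_lborel_translate[of "\<lambda>y. indicator A y * indicator (ball 0 1) (y - T x)" "T x", symmetric])
         auto
  qed
  also have "\<dots> = (\<integral>\<^sup>+y. (\<integral>\<^sup>+x. indicator A y * indicator (ball 0 1) (y - T x) \<partial>lborel) \<partial>lborel)"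
  proof (rule lborel_pair.Fubini')
    have [measurable]: "(\<lambda>p. fst p - T (snd p)) \<in> (lborel \<Otimes>\<^sub>M lborel) \<rightarrow>\<^sub>M (borel :: 'a measure)"
      by measurable
    show "(\<lambda>(y, x). indicator A y * indicator (ball 0 1) (y - T x) :: ennreal)
        \<in> borel_measurable (lborel \<Otimes>\<^sub>M lborel)"
      unfolding split_beta'
      by (intro borel_measurable_times_ennreal measurable_compose[where N = borel, OF _ borel_measurable_indicator]) simp_all
  qed
  also have "\<dots> = (\<integral>\<^sup>+y. indicator A y * C \<partial>lborel)"
    by (simp add: nn_integral_cmult Cball)
  also have "\<dots> = emeasure lborel A * C"
    by (simp add: nn_integral_multc)
  finally have "emeasure (distr lborel borel T) A * C = emeasure lborel A * C" .
  moreover have "C < \<infinity>" unfolding C_def by (rule emeasure_lborel_ball_finite)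
  moreover have "C \<noteq> 0"
  proof
    assume "C = 0"
    then have "ball (0::'a) 1 \<in> null_sets lborel" unfolding C_def by (intro null_setsI) auto
    then have "negligible (ball (0::'a) 1)"
      by (simp add: negligible_iff_null_sets null_sets_completionI)
    then show False using open_not_negligible[of "ball (0::'a) 1"] by simp
  qed
  ultimately show "emeasure (distr lborel borel T) A = emeasure lborel A"
    by (metis ennreal_mult_divide_eq less_irrefl infinity_ennreal_def)
qed simp

text \<open>The Gaussian weight of \<open>FS_integral\<close>, normalized to mass 1. On functions
  invariant under complex scaling it therefore integrates like the normalized Fubini-Study volume,
  and its rotation invariance replaces that of projective space.\<close>

definition fs_measure :: "(complex^'n) measure" where
  "fs_measure = density lborel (\<lambda>z. ennreal (exp (- (norm z)\<^sup>2) / pi ^ CARD('n)))"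

lemma space_fs_measure [simp]: "space fs_measure = UNIV"
  and sets_fs_measure [simp, measurable_cong]: "sets fs_measure = sets borel"
  by (simp_all add: fs_measure_def)

lemma nn_integral_gaussian: "(\<integral>\<^sup>+x. ennreal (exp (- x\<^sup>2)) \<partial>lborel) = ennreal (sqrt pi)"
proof -
  have "normal_density 0 (1 / sqrt 2) x = exp (- x\<^sup>2) / sqrt pi" for x
    by (simp add: normal_density_def field_simps real_sqrt_mult)
  then have e: "ennreal (exp (- x\<^sup>2)) = ennreal (sqrt pi) * ennreal (normal_density 0 (1 / sqrt 2) x)" for x
    by (simp flip: ennreal_mult)
  have "(\<integral>\<^sup>+x. ennreal (normal_density 0 (1 / sqrt 2) x) \<partial>lborel) = 1"
    using prob_space.emeasure_space_1[OF prob_space_normal_density[of "1 / sqrt 2" 0]]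
    by (simp add: emeasure_density)
  then show ?thesis unfolding e by (simp add: nn_integral_cmult)
qed

lemma nn_integral_gaussian_vec:
  "(\<integral>\<^sup>+(z::complex^'n). ennreal (exp (- (norm z)\<^sup>2)) \<partial>lborel) = ennreal (pi ^ CARD('n))"
proof -
  have "(norm z)\<^sup>2 = (\<Sum>b\<in>Basis. (z \<bullet> b)\<^sup>2)" for z :: "complex^'n"
    unfolding power2_norm_eq_inner by (subst euclidean_inner) (simp add: power2_eq_square)
  then have "ennreal (exp (- (norm z)\<^sup>2)) = (\<Prod>b\<in>Basis. ennreal (exp (- (z \<bullet> b)\<^sup>2)))" for z :: "complex^'n"
    by (simp add: prod_ennreal exp_sum[symmetric] sum_negf)
  then have "(\<integral>\<^sup>+(z::complex^'n). ennreal (exp (- (norm z)\<^sup>2)) \<partial>lborel)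
      = (\<Prod>b\<in>(Basis :: (complex^'n) set). \<integral>\<^sup>+x. ennreal (exp (- x\<^sup>2)) \<partial>lborel)"
    by (simp only:) (rule nn_integral_lborel_prod, auto)
  also have "\<dots> = ennreal (sqrt pi) ^ (CARD('n) * 2)"
    by (simp add: nn_integral_gaussian)
  also have "\<dots> = ennreal (pi ^ CARD('n))"
    by (simp add: ennreal_power mult.commute[of _ 2] power_mult)
  finally show ?thesis .
qed

lemma prob_space_fs_measure: "prob_space (fs_measure :: (complex^'n) measure)"
proof
  have "emeasure (fs_measure :: (complex^'n) measure) UNIV
      = (\<integral>\<^sup>+(z::complex^'n). ennreal (exp (- (norm z)\<^sup>2)) * ennreal (1 / pi ^ CARD('n)) \<partial>lborel)"
    unfolding fs_measure_def by (simp add: emeasure_density flip: ennreal_mult)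
  also have "\<dots> = ennreal (pi ^ CARD('n)) * ennreal (1 / pi ^ CARD('n))"
    by (subst nn_integral_multc) (simp_all add: nn_integral_gaussian_vec)
  also have "\<dots> = 1"
    by (simp flip: ennreal_mult)
  finally show "emeasure (fs_measure :: (complex^'n) measure) (space fs_measure) = 1" by simp
qed

lemma distr_fs_measure_orthogonal:
  fixes T :: "complex^'n \<Rightarrow> complex^'n"
  assumes T: "orthogonal_transformation T"
  shows "distr fs_measure borel T = fs_measure"
proof (rule measure_eqI)
  fix A assume "A \<in> sets (distr fs_measure borel T)"
  then have [measurable]: "A \<in> sets borel" by simp
  have lin: "linear T" and nT: "\<And>x. norm (T x) = norm x"
    using T by (auto simp: orthogonal_transformation)
  have [measurable]: "T \<in> borel_measurable borel"
    by (rule borel_measurable_continuous_onI[OF linear_continuous_on])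
       (simp add: lin linear_conv_bounded_linear[symmetric])
  have "emeasure (distr fs_measure borel T) A = (\<integral>\<^sup>+z. ennreal (exp (- (norm (T z))\<^sup>2) / pi ^ CARD('n)) * indicator A (T z) \<partial>lborel)"
    by (simp add: nn_integral_distr fs_measure_def nn_integral_density nT flip: nn_integral_indicator)
  also have "\<dots> = (\<integral>\<^sup>+z. ennreal (exp (- (norm z)\<^sup>2) / pi ^ CARD('n)) * indicator A z \<partial>distr lborel borel T)"
    by (subst nn_integral_distr) auto
  also have "\<dots> = emeasure fs_measure A"
    unfolding lborel_distr_orthogonal[OF T] by (simp add: fs_measure_def emeasure_density)
  finally show "emeasure (distr fs_measure borel T) A = emeasure fs_measure A" .
qed simp

lemma integral_fs_measure_orthogonal:
  fixes T :: "complex^'n \<Rightarrow> complex^'n" and f :: "complex^'n \<Rightarrow> 'b::{banach, second_countable_topology}"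
  assumes T: "orthogonal_transformation T" and f: "f \<in> borel_measurable borel"
  shows "(\<integral>z. f (T z) \<partial>fs_measure) = (\<integral>z. f z \<partial>fs_measure)"
proof -
  have "linear T" using T by (auto simp: orthogonal_transformation)
  then have "T \<in> borel_measurable borel"
    by (intro borel_measurable_continuous_onI linear_continuous_on)
       (simp add: linear_conv_bounded_linear[symmetric])
  then have "(\<integral>z. f z \<partial>distr fs_measure borel T) = (\<integral>z. f (T z) \<partial>fs_measure)"
    using f by (intro integral_distr) auto
  then show ?thesis using distr_fs_measure_orthogonal[OF T] by simp
qed

lemma AE_fs_measure:
  assumes "AE z in lborel. P z"
  shows "AE z in fs_measure. P z"
  unfolding fs_measure_def using assms by (simp add: AE_density)

lemma AE_fs_measure_nonzero: "AE z in fs_measure. z \<noteq> (0 :: complex^'n)"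
  by (rule AE_fs_measure) (rule AE_lborel_singleton)

lemma AE_not_proj_eq:
  fixes x :: "complex^'n"
  assumes x: "x \<noteq> 0" and n: "CARD('n) \<ge> 2"
  shows "AE z in fs_measure. \<not> proj_eq x z"
proof -
  obtain j where j: "x $ j \<noteq> 0" using x by (auto simp: vec_eq_iff)
  have "\<exists>k. k \<noteq> j"
  proof (rule ccontr)
    assume "\<nexists>k. k \<noteq> j"
    then have "(UNIV :: 'n set) = {j}" by auto
    then have "CARD('n) = card {j}" by simp
    then show False using n by simp
  qed
  then obtain k where k: "k \<noteq> j" by blast
  \<comment> \<open>With this choice \<open>a \<bullet> z\<close> is the real part of
    \<open>x $ j * z $ k - x $ k * z $ j\<close>, a minor that vanishes on all multiples of
    \<open>x\<close>; they thus lie in a real hyperplane, which is a null set.\<close>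
  define a :: "complex^'n" where "a = axis k (cnj (x $ j)) - axis j (cnj (x $ k))"
  have "a $ k \<noteq> 0" using j k by (simp add: a_def axis_def)
  then have "a \<noteq> 0" by auto
  then have "negligible {z. a \<bullet> z = 0}" using negligible_hyperplane[of a 0] by simp
  then have "AE z in lebesgue. a \<bullet> z \<noteq> 0"
    by (auto simp: negligible_iff_null_sets dest!: AE_not_in)
  then have "AE z in lborel. a \<bullet> z \<noteq> 0"
    by (subst (asm) AE_completion_iff) auto
  moreover have "a \<bullet> z = 0" if "proj_eq x z" for z
    using that by (auto simp: proj_eq_def a_def inner_diff_left inner_axis' inner_complex_def algebra_simps)
  ultimately show ?thesis by (intro AE_fs_measure) auto
qed

text \<open>The two normalizations differ by pi^(d+1) / (pi d!), which is the volume pi^d /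
  d!.\<close>

lemma FS_integral_eq:
  assumes "F \<in> borel_measurable borel"
  shows "FS_integral F = FS_volume TYPE('n) * (\<integral>(z::complex^'n). F z \<partial>fs_measure)"
proof -
  have "(\<integral>(z::complex^'n). F z \<partial>fs_measure) = (\<integral>z. (exp (- (norm z)\<^sup>2) / pi ^ CARD('n)) * F z \<partial>lborel)"
    unfolding fs_measure_def using assms by (subst integral_density) auto
  also have "\<dots> = (\<integral>z. F z * exp (- (norm z)\<^sup>2) \<partial>lborel) / pi ^ CARD('n)"
    by (subst Bochner_Integration.integral_divide_zero[symmetric]) (simp add: mult.commute)
  finally have "(\<integral>z. F z * exp (- (norm z)\<^sup>2) \<partial>lborel) = pi ^ CARD('n) * (\<integral>z. F z \<partial>fs_measure)"
    by simp
  moreover have "pi ^ CARD('n) = pi * pi ^ (CARD('n) - 1)"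
    by (simp flip: power_Suc)
  ultimately show ?thesis
    unfolding FS_integral_def FS_volume_def by simp
qed

lemma FS_integrableD:
  fixes F :: "complex^'n \<Rightarrow> real"
  assumes "FS_integrable F"
  shows "F \<in> borel_measurable borel" "integrable fs_measure F"
proof -
  have i: "integrable lborel (\<lambda>z. F z * exp (- (norm z)\<^sup>2))"
    using assms by (simp add: FS_integrable_def)
  then have "(\<lambda>z. F z * exp (- (norm z)\<^sup>2)) \<in> borel_measurable borel"
    using borel_measurable_integrable by fastforce
  then have "(\<lambda>z. (F z * exp (- (norm z)\<^sup>2)) / exp (- (norm z)\<^sup>2)) \<in> borel_measurable borel"
    by measurable
  then show m: "F \<in> borel_measurable borel" by simp
  have "integrable lborel (\<lambda>z. (1 / pi ^ CARD('n)) * (F z * exp (- (norm z)\<^sup>2)))"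
    using i by (rule integrable_mult_right)
  then show "integrable fs_measure F"
    unfolding fs_measure_def using m by (subst integrable_density) (auto simp: field_simps)
qed

section \<open>Reproducing kernels and moments\<close>

text \<open>Normalizing by \<open>sgn\<close> gives the value 0 at the zero vector, so that the
  modulus is at most 1 everywhere, with no case distinction.\<close>

definition hcos :: "complex^'n \<Rightarrow> complex^'n \<Rightarrow> complex" where
  "hcos x y = herm (sgn x) (sgn y)"

definition cos2 :: "complex^'n \<Rightarrow> complex^'n \<Rightarrow> real" where
  "cos2 x y = (cmod (hcos x y))\<^sup>2"

lemma hcos_cnj: "hcos y x = cnj (hcos x y)"
  unfolding hcos_def by (rule herm_cnj)

lemma cos2_commute: "cos2 y x = cos2 x y"
  unfolding cos2_def by (subst hcos_cnj) simp

lemma cmod_hcos_le_1: "cmod (hcos x y) \<le> 1"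
proof -
  have "cmod (hcos x y) \<le> norm (sgn x) * norm (sgn y)"
    unfolding hcos_def by (rule cmod_herm_le)
  also have "\<dots> \<le> 1" by (simp add: norm_sgn)
  finally show ?thesis .
qed

lemma cos2_nonneg [simp]: "0 \<le> cos2 x y"
  by (simp add: cos2_def)

lemma cos2_le_1 [simp]: "cos2 x y \<le> 1"
  unfolding cos2_def using cmod_hcos_le_1[of x y] by (simp add: power_le_one)

lemma cos2_eq: "cos2 x y = (cmod (herm x y))\<^sup>2 / ((norm x)\<^sup>2 * (norm y)\<^sup>2)"
  by (simp add: cos2_def hcos_def sgn_div_norm scaleR_eq_vector_scalar_mult herm_scale_left
        herm_scale_right norm_mult norm_divide norm_inverse power_mult_distrib power_divide field_simps)

lemma cos2_scale_right: "c \<noteq> 0 \<Longrightarrow> cos2 x (c *s y) = cos2 x y"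
  by (simp add: cos2_eq herm_scale_right norm_mult norm_vector_scalar_mult power_mult_distrib)

lemma hcos_self: "x \<noteq> 0 \<Longrightarrow> hcos x x = 1"
  by (simp add: hcos_def herm_self norm_sgn)

lemma cos2_self: "x \<noteq> 0 \<Longrightarrow> cos2 x x = 1"
  by (simp add: cos2_def hcos_self)

lemma borel_measurable_sgn_vec [measurable]: "(sgn :: complex^'n \<Rightarrow> _) \<in> borel_measurable borel"
  unfolding sgn_div_norm[abs_def] by measurable

lemma measurable_hcos [measurable]: "(\<lambda>(x, y). hcos x y) \<in> borel_measurable (borel \<Otimes>\<^sub>M borel)"
  unfolding hcos_def by measurable

lemma measurable_hcos_right [measurable]: "hcos x \<in> borel_measurable borel"
  "(\<lambda>y. hcos y x) \<in> borel_measurable borel"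
  unfolding hcos_def[abs_def] by measurable

lemma measurable_cos2_right [measurable]: "cos2 x \<in> borel_measurable borel"
  unfolding cos2_def[abs_def] by measurable

interpretation fs: prob_space "fs_measure :: (complex^'n) measure"
  by (rule prob_space_fs_measure)

lemma measure_fs_measure_UNIV [simp]: "measure fs_measure UNIV = 1"
  using fs.prob_space by simp

text \<open>For a unit vector \<open>x\<close> and a phase \<open>c\<close>, the unitary complex
  reflection that multiplies the component along \<open>x\<close> by \<open>c\<close> and fixes the
  orthogonal complement of \<open>x\<close>.\<close>

definition phase_map :: "complex^'n \<Rightarrow> complex \<Rightarrow> complex^'n \<Rightarrow> complex^'n" where
  "phase_map x c y = y + ((c - 1) * herm y x) *s x"

lemma herm_phase_map:
  assumes "norm x = 1"
  shows "herm (phase_map x c y) x = c * herm y x"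
  unfolding phase_map_def herm_add_left herm_scale_left herm_self assms by (simp add: algebra_simps)

lemma herm_phase_map_orthogonal:
  "herm x z = 0 \<Longrightarrow> herm (phase_map x c y) z = herm y z"
  by (simp add: phase_map_def herm_add_left herm_scale_left)

lemma orthogonal_transformation_phase_map:
  assumes x: "norm x = 1" and c: "cmod c = 1"
  shows "orthogonal_transformation (phase_map x c)"
  unfolding orthogonal_transformation
proof (intro conjI allI)
  show "linear (phase_map x c)"
  proof (rule linearI)
    show "phase_map x c (y + z) = phase_map x c y + phase_map x c z" for y z
      by (simp add: phase_map_def herm_add_left vec_eq_iff algebra_simps)
    show "phase_map x c (r *\<^sub>R y) = r *\<^sub>R phase_map x c y" for r y
      by (simp add: phase_map_def scaleR_eq_vector_scalar_mult herm_scale_left vec_eq_iff algebra_simps)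
  qed
  fix y
  have x0: "x \<noteq> 0" using x by auto
  have "phase_map x c y - herm (phase_map x c y) x *s x = y - herm y x *s x"
    by (simp add: herm_phase_map[OF x]) (simp add: phase_map_def vec_eq_iff algebra_simps)
  then have "(norm (phase_map x c y))\<^sup>2 = (norm y)\<^sup>2"
    using norm_sub_projection[OF x0, of y] norm_sub_projection[OF x0, of "phase_map x c y"]
    by (simp add: x herm_phase_map[OF x] norm_mult c)
  then show "norm (phase_map x c y) = norm y" by simp
qed

lemma sgn_phase_map:
  assumes x: "norm x = 1" and c: "cmod c = 1"
  shows "sgn (phase_map x c y) = phase_map x c (sgn y)"
  using orthogonal_transformation_phase_map[OF x c]
  by (auto simp: sgn_div_norm orthogonal_transformation linear_scale)

text \<open>A phase rotation about \<open>x\<close> preserves the measure and multiplies the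
  integrand by \<open>cnj c ^ L * c ^ j\<close>, the conjugate of \<open>c ^ (L - j)\<close>. As
  \<open>j < L\<close>, a phase \<open>c\<close> exists for which this factor is -1.\<close>

lemma integral_mixed_eq_0:
  fixes x z :: "complex^'n"
  assumes x: "norm x = 1" and xz: "herm x z = 0" and j: "j < L"
  shows "(\<integral>y. herm x (sgn y) ^ L * (herm (sgn y) x ^ j * herm (sgn y) z ^ (L - j)) \<partial>fs_measure) = 0"
proof -
  define f where "f y = herm x (sgn y) ^ L * (herm (sgn y) x ^ j * herm (sgn y) z ^ (L - j))" for y :: "complex^'n"
  define c where "c = cis (pi / real (L - j))"
  have c: "cmod c = 1" by (simp add: c_def)
  have "cis (pi / real n) ^ n = -1" if "n > 0" for n
    using that unfolding Complex.DeMoivre by (simp add: cis_pi)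
  then have "c ^ (L - j) = -1"
    using j unfolding c_def by (meson zero_less_diff)
  moreover have "cnj c ^ L * c ^ j = cnj (c ^ (L - j))"
  proof -
    have "cnj c * c = 1" using c complex_norm_square[of c] by (simp add: mult.commute)
    then have "cnj c ^ j * c ^ j = 1" by (simp flip: power_mult_distrib)
    moreover have "cnj c ^ L = cnj c ^ (L - j) * cnj c ^ j"
      using j by (simp flip: power_add)
    ultimately show ?thesis by (simp add: mult.assoc)
  qed
  ultimately have cc: "cnj c ^ L * c ^ j = -1" by simp
  have h: "herm x (sgn (phase_map x c y)) = cnj c * herm x (sgn y)" for y
    using herm_phase_map[OF x, of c "sgn y"]
    by (subst herm_cnj, subst (2) herm_cnj) (simp add: sgn_phase_map[OF x c])
  have "f (phase_map x c y) = (cnj c ^ L * c ^ j) * f y" for y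
    unfolding f_def h
    by (simp add: sgn_phase_map[OF x c] herm_phase_map[OF x] herm_phase_map_orthogonal[OF xz] power_mult_distrib)
  then have "f (phase_map x c y) = - f y" for y
    unfolding cc by simp
  moreover have "(\<integral>y. f (phase_map x c y) \<partial>fs_measure) = (\<integral>y. f y \<partial>fs_measure)"
    by (rule integral_fs_measure_orthogonal[OF orthogonal_transformation_phase_map[OF x c]])
       (simp add: f_def[abs_def])
  ultimately have "(\<integral>y. f y \<partial>fs_measure) = 0" by simp
  then show ?thesis unfolding f_def .
qed

definition fs_moment :: "nat \<Rightarrow> complex^'n \<Rightarrow> real" where
  "fs_moment L x = (\<integral>y. cos2 x y ^ L \<partial>fs_measure)"

text \<open>Splitting \<open>sgn z\<close> into its parts along \<open>x\<close> and orthogonal to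
  \<open>x\<close> and expanding the power, every term but the one free of the orthogonal part has
  integral 0. The constant is left as a moment that may at this stage still depend on
  \<open>x\<close>.\<close>

lemma integral_hcos_power:
  fixes x z :: "complex^'n"
  assumes x: "x \<noteq> 0"
  shows "(\<integral>y. hcos x y ^ L * hcos y z ^ L \<partial>fs_measure) = of_real (fs_moment L x) * hcos x z ^ L"
proof -
  define e where "e = sgn x"
  define \<alpha> where "\<alpha> = herm e (sgn z)"
  define z' where "z' = sgn z - cnj \<alpha> *s e"
  have e: "norm e = 1" using x by (simp add: e_def norm_sgn)
  have z: "sgn z = z' + cnj \<alpha> *s e" by (simp add: z'_def)
  have "herm e (sgn z) = herm e z' + \<alpha> * herm e e"
    by (subst z) (simp add: herm_add_right herm_scale_right)
  then have ez: "herm e z' = 0" by (simp add: \<alpha>_def[symmetric] herm_self e)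
  define T where "T j y = herm e (sgn y) ^ L * (herm (sgn y) e ^ j * herm (sgn y) z' ^ (L - j))" for j y
  have "hcos y z = \<alpha> * herm (sgn y) e + herm (sgn y) z'" for y
    unfolding hcos_def by (subst z) (simp add: herm_add_right herm_scale_right)
  then have "hcos x y ^ L * hcos y z ^ L = (\<Sum>j\<le>L. of_nat (L choose j) * \<alpha> ^ j * T j y)" for y
    by (simp add: hcos_def e_def[symmetric] binomial_ring sum_distrib_left power_mult_distrib T_def mult_ac)
  moreover have T: "integrable fs_measure (T j)" for j
  proof -
    have s: "cmod (herm u (sgn y)) \<le> norm u" "cmod (herm (sgn y) u) \<le> norm u" for u y :: "complex^'n"
    proof -
      have "cmod (herm u (sgn y)) \<le> norm u * norm (sgn y)" by (rule cmod_herm_le)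
      also have "\<dots> \<le> norm u" by (simp add: norm_sgn)
      finally show "cmod (herm u (sgn y)) \<le> norm u" .
      then show "cmod (herm (sgn y) u) \<le> norm u" by (simp add: cmod_herm_commute)
    qed
    show ?thesis
    proof (rule fs.integrable_const_bound[of _ "norm e ^ L * (norm e ^ j * norm z' ^ (L - j))"])
      show "T j \<in> borel_measurable fs_measure" unfolding T_def[abs_def] by measurable
      show "AE y in fs_measure. cmod (T j y) \<le> norm e ^ L * (norm e ^ j * norm z' ^ (L - j))"
        unfolding T_def norm_mult norm_power by (intro AE_I2 mult_mono power_mono s) auto
    qed
  qed
  ultimately have "(\<integral>y. hcos x y ^ L * hcos y z ^ L \<partial>fs_measure)
      = (\<Sum>j\<le>L. of_nat (L choose j) * \<alpha> ^ j * (\<integral>y. T j y \<partial>fs_measure))"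
    by (simp add: Bochner_Integration.integral_sum)
  also have "\<dots> = (\<Sum>j\<in>{L}. of_nat (L choose j) * \<alpha> ^ j * (\<integral>y. T j y \<partial>fs_measure))"
    by (rule sum.mono_neutral_right)
       (use integral_mixed_eq_0[OF e ez] in \<open>auto simp: T_def\<close>)
  also have "\<dots> = \<alpha> ^ L * (\<integral>y. T L y \<partial>fs_measure)" by simp
  also have "(\<integral>y. T L y \<partial>fs_measure) = of_real (fs_moment L x)"
  proof -
    have "T L y = of_real (cos2 x y ^ L)" for y
    proof -
      have "T L y = (hcos x y * cnj (hcos x y)) ^ L"
        unfolding T_def hcos_def e_def[symmetric]
        by (simp add: power_mult_distrib herm_cnj[of "sgn y" e])
      then show ?thesis
        unfolding cos2_def complex_norm_square[symmetric] by simp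
    qed
    then show ?thesis
      unfolding fs_moment_def by (simp only: integral_complex_of_real)
  qed
  finally show ?thesis
    unfolding \<alpha>_def hcos_def e_def by (simp add: mult.commute)
qed

text \<open>The reproducing integral can be evaluated from \<open>x\<close> or, after conjugation,
  from \<open>z\<close>; both give the same nonzero power of \<open>hcos x z\<close>, so the moments
  agree. This replaces transitivity of the unitary group.\<close>

lemma fs_moment_cong_nonorthogonal:
  fixes x z :: "complex^'n"
  assumes x: "x \<noteq> 0" and z: "z \<noteq> 0" and xz: "herm x z \<noteq> 0"
  shows "fs_moment L x = fs_moment L z"
proof -
  have "cnj (\<integral>y. hcos z y ^ L * hcos y x ^ L \<partial>fs_measure) = (\<integral>y. hcos x y ^ L * hcos y z ^ L \<partial>fs_measure)"
  proof -
    have "hcos x y ^ L * hcos y z ^ L = cnj (hcos z y ^ L * hcos y x ^ L)" for y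
      using hcos_cnj[of y x] hcos_cnj[of y z] by simp
    then show ?thesis
      by (simp only: Bochner_Integration.integral_cnj)
  qed
  then have "of_real (fs_moment L x) * hcos x z ^ L = cnj (of_real (fs_moment L z) * hcos z x ^ L)"
    by (simp only: integral_hcos_power[OF x] integral_hcos_power[OF z])
  also have "\<dots> = of_real (fs_moment L z) * hcos x z ^ L"
    by (simp add: hcos_cnj[of z x])
  finally have "of_real (fs_moment L x) * hcos x z ^ L = of_real (fs_moment L z) * hcos x z ^ L" .
  moreover have "hcos x z \<noteq> 0"
  proof -
    have "cos2 x z \<noteq> 0" using assms by (simp add: cos2_eq)
    then show ?thesis by (auto simp: cos2_def)
  qed
  ultimately show ?thesis by simp
qed

text \<open>Orthogonal vectors are compared through their sum, which is orthogonal to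
  neither.\<close>

lemma fs_moment_cong:
  fixes x z :: "complex^'n"
  assumes x: "x \<noteq> 0" and z: "z \<noteq> 0"
  shows "fs_moment L x = fs_moment L z"
proof (cases "herm x z = 0")
  case True
  have "herm x (x + z) = herm x x" "herm z (x + z) = herm z z"
    using True herm_cnj[of z x] by (simp_all add: herm_add_right)
  then have xz: "herm x (x + z) \<noteq> 0" "herm z (x + z) \<noteq> 0" using x z by (simp_all add: herm_self)
  then have "x + z \<noteq> 0" by auto
  then show ?thesis
    using fs_moment_cong_nonorthogonal[OF x _ xz(1)] fs_moment_cong_nonorthogonal[OF z _ xz(2)] by metis
qed (rule fs_moment_cong_nonorthogonal[OF x z])

text \<open>Comparing coefficients of polynomials in a parameter takes the place of differentiating
  under the integral sign.\<close>

lemma integral_poly_coeff: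
  fixes P :: "'a \<Rightarrow> real poly"
  assumes int: "\<And>i. integrable M (\<lambda>y. coeff (P y) i)"
    and deg: "\<And>y. degree (P y) \<le> N"
    and eq: "\<And>s. (\<integral>y. poly (P y) s \<partial>M) = poly Q s"
  shows "(\<integral>y. coeff (P y) i \<partial>M) = coeff Q i"
proof -
  define R where "R = (\<Sum>i\<le>N. monom (\<integral>y. coeff (P y) i \<partial>M) i)"
  have P: "poly (P y) s = (\<Sum>i\<le>N. coeff (P y) i * s ^ i)" for y s
    unfolding poly_altdef
    by (rule sum.mono_neutral_left) (use deg coeff_eq_0[of "P y"] in \<open>auto simp: not_le\<close>)
  have "poly R s = poly Q s" for s
    unfolding eq[symmetric] P R_def
    using int by (simp add: poly_sum poly_monom Bochner_Integration.integral_sum)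
  then have "R = Q" by (simp add: poly_eq_poly_eq_iff[symmetric] fun_eq_iff)
  moreover have "coeff R i = (\<integral>y. coeff (P y) i \<partial>M)"
  proof (cases "i \<le> N")
    case True
    then show ?thesis by (simp add: R_def coeff_sum)
  next
    case False
    then have "coeff (P y) i = 0" for y using deg[of y] by (intro coeff_eq_0) simp
    then show ?thesis using False by (simp add: R_def coeff_sum)
  qed
  ultimately show ?thesis by simp
qed

text \<open>A square of the variable comes either from one factor \<open>B\<close> or from two
  factors \<open>R\<close>; for \<open>n = 0\<close> the second contribution disappears through its
  factor \<open>real n\<close>.\<close>

lemma coeff_quadratic_power:
  fixes A B R :: real
  shows "coeff ([:A, R, B:] ^ Suc n) 2 = real (Suc n) * A ^ n * B + real (Suc n) * real n / 2 * A ^ (n - 1) * R\<^sup>2"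
proof -
  have 0: "coeff ([:A, R, B:] ^ n) 0 = A ^ n" for n
    by (simp add: coeff_0_power)
  have 1: "coeff ([:A, R, B:] ^ n) 1 = real n * A ^ (n - 1) * R" for n
  proof (induction n)
    case (Suc n)
    have "coeff ([:A, R, B:] ^ Suc n) 1 = A * coeff ([:A, R, B:] ^ n) 1 + R * coeff ([:A, R, B:] ^ n) 0"
      by (simp add: coeff_pCons)
    also have "\<dots> = real (Suc n) * A ^ (Suc n - 1) * R"
      unfolding Suc.IH 0 by (cases n) (simp_all add: algebra_simps)
    finally show ?case .
  qed simp
  show ?thesis
  proof (induction n)
    case (Suc n)
    have "coeff ([:A, R, B:] ^ Suc (Suc n)) 2 = A * coeff ([:A, R, B:] ^ Suc n) 2
        + R * coeff ([:A, R, B:] ^ Suc n) 1 + B * coeff ([:A, R, B:] ^ Suc n) 0"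
      by (subst power_Suc) (simp add: coeff_pCons numeral_2_eq_2 split: nat.splits del: power_Suc)
    also have "\<dots> = real (Suc (Suc n)) * A ^ Suc n * B + real (Suc (Suc n)) * real (Suc n) / 2 * A ^ (Suc n - 1) * R\<^sup>2"
      unfolding Suc.IH 1 0 by (cases n) (simp_all add: field_simps power2_eq_square)
    finally show ?case .
  qed (simp add: numeral_2_eq_2)
qed

lemma coeff_quadratic_power_bounded:
  fixes A B R :: "'a \<Rightarrow> real"
  assumes [measurable]: "A \<in> borel_measurable M" "R \<in> borel_measurable M" "B \<in> borel_measurable M"
    and bound: "\<And>y. \<bar>A y\<bar> \<le> C" "\<And>y. \<bar>R y\<bar> \<le> C" "\<And>y. \<bar>B y\<bar> \<le> C"
  shows "(\<lambda>y. coeff ([:A y, R y, B y:] ^ n) i) \<in> borel_measurable M \<and>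
    (\<exists>D. \<forall>y. \<bar>coeff ([:A y, R y, B y:] ^ n) i\<bar> \<le> D)"
proof (induction n arbitrary: i)
  case 0
  show ?case by (cases i) auto
next
  case (Suc n)
  define c where "c i y = coeff ([:A y, R y, B y:] ^ n) i" for i y
  have [measurable]: "c i \<in> borel_measurable M" for i
    using Suc.IH[of i] by (simp add: c_def[abs_def])
  have cb: "\<exists>D. \<forall>y. \<bar>c i y\<bar> \<le> D" for i
    using Suc.IH[of i] by (simp add: c_def)
  define d where "d y = A y * c i y + (if i \<ge> 1 then R y * c (i - 1) y else 0)
      + (if i \<ge> 2 then B y * c (i - 2) y else 0)" for y
  have e: "coeff ([:A y, R y, B y:] ^ Suc n) i = d y" for y
    by (auto simp: d_def c_def coeff_pCons algebra_simps numeral_2_eq_2 split: nat.splits)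
  have "d \<in> borel_measurable M" unfolding d_def[abs_def] by measurable
  moreover have "\<exists>D. \<forall>y. \<bar>d y\<bar> \<le> D"
  proof -
    obtain D0 D1 D2 where D: "\<And>y. \<bar>c i y\<bar> \<le> D0" "\<And>y. \<bar>c (i - 1) y\<bar> \<le> D1" "\<And>y. \<bar>c (i - 2) y\<bar> \<le> D2"
      using cb by meson
    have C: "C \<ge> 0" using order_trans[OF abs_ge_zero bound(1)] .
    have Dn: "D1 \<ge> 0" "D2 \<ge> 0" using order_trans[OF abs_ge_zero D(2)] order_trans[OF abs_ge_zero D(3)] .
    have "\<bar>d y\<bar> \<le> C * D0 + C * D1 + C * D2" for y
    proof -
      have "\<bar>A y * c i y\<bar> \<le> C * D0" "\<bar>R y * c (i - 1) y\<bar> \<le> C * D1" "\<bar>B y * c (i - 2) y\<bar> \<le> C * D2"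
        unfolding abs_mult by (intro mult_mono bound D C abs_ge_zero)+
      moreover have "0 \<le> C * D1" "0 \<le> C * D2" using C Dn by simp_all
      ultimately show ?thesis unfolding d_def by (auto simp: abs_le_iff)
    qed
    then show ?thesis by blast
  qed
  ultimately show ?case unfolding e by simp
qed

text \<open>Compares the coefficients of \<open>s\<^sup>2\<close> in
  \<open>\<integral>|\<langle>x + s b, sgn y\<rangle>|\<^bsup>2(n+1)\<^esup> d\<mu>(y) = fs_moment (n+1) x * |x + s b|\<^bsup>2(n+1)\<^esup>\<close>.\<close>

lemma fs_moment_second_variation:
  fixes x b :: "complex^'n"
  assumes x: "norm x = 1" and b: "norm b = 1"
  defines "A \<equiv> \<lambda>y. (cmod (herm x (sgn y)))\<^sup>2" and "B \<equiv> \<lambda>y. (cmod (herm b (sgn y)))\<^sup>2"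
    and "R \<equiv> \<lambda>y. 2 * ((x \<bullet> sgn y) * (b \<bullet> sgn y) + (x \<bullet> (\<i> *s sgn y)) * (b \<bullet> (\<i> *s sgn y)))"
  shows "integrable fs_measure (\<lambda>y. real (Suc n) * A y ^ n * B y + real (Suc n) * real n / 2 * A y ^ (n - 1) * (R y)\<^sup>2)"
    and "(\<integral>y. real (Suc n) * A y ^ n * B y + real (Suc n) * real n / 2 * A y ^ (n - 1) * (R y)\<^sup>2 \<partial>fs_measure)
      = fs_moment (Suc n) x * (real (Suc n) + 2 * real (Suc n) * real n * (x \<bullet> b)\<^sup>2)"
proof -
  define P where "P y = [:A y, R y, B y:] ^ Suc n" for y
  have [measurable]: "A \<in> borel_measurable borel" "B \<in> borel_measurable borel"
    unfolding A_def B_def by measurable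
  have R_alt: "R y = 2 * (Re (herm x (sgn y)) * Re (herm b (sgn y)) + Im (herm x (sgn y)) * Im (herm b (sgn y)))" for y
    unfolding R_def Re_herm Im_herm ..
  have [measurable]: "R \<in> borel_measurable borel"
    unfolding R_alt[abs_def] by measurable
  have le1: "cmod (herm u (sgn y)) \<le> 1" if "norm u = 1" for u y :: "complex^'n"
  proof -
    have "cmod (herm u (sgn y)) \<le> norm u * norm (sgn y)" by (rule cmod_herm_le)
    also have "\<dots> \<le> 1" by (simp add: norm_sgn that)
    finally show ?thesis .
  qed
  have AB: "\<bar>A y\<bar> \<le> 4" "\<bar>B y\<bar> \<le> 4" for y
    using power_le_one[OF norm_ge_zero le1[OF x, of y], of 2] power_le_one[OF norm_ge_zero le1[OF b, of y], of 2]
    by (simp_all add: A_def B_def)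
  have Rb: "\<bar>R y\<bar> \<le> 4" for y
  proof -
    have "\<bar>Re (herm x (sgn y)) * Re (herm b (sgn y))\<bar> \<le> 1 * 1"
      "\<bar>Im (herm x (sgn y)) * Im (herm b (sgn y))\<bar> \<le> 1 * 1"
      unfolding abs_mult
      by (intro mult_mono order_trans[OF abs_Re_le_cmod] order_trans[OF abs_Im_le_cmod] le1 x b; simp)+
    then show ?thesis unfolding R_alt by (auto simp: abs_le_iff)
  qed
  have int: "integrable fs_measure (\<lambda>y. coeff (P y) i)" for i
  proof -
    obtain D where "\<And>y. \<bar>coeff (P y) i\<bar> \<le> D" and [measurable]: "(\<lambda>y. coeff (P y) i) \<in> borel_measurable borel"
      using coeff_quadratic_power_bounded[of A borel R B 4 "Suc n" i] AB Rb unfolding P_def by auto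
    then show ?thesis by (intro fs.integrable_const_bound[of _ D]) auto
  qed
  have deg: "degree (P y) \<le> Suc n * 2" for y
  proof -
    have "degree (P y) \<le> degree [:A y, R y, B y:] * Suc n" unfolding P_def by (rule degree_power_le)
    also have "\<dots> \<le> 2 * Suc n" by (intro mult_le_mono1) (simp add: degree_pCons_eq_if)
    finally show ?thesis by simp
  qed
  have eq: "(\<integral>y. poly (P y) s \<partial>fs_measure) = poly (smult (fs_moment (Suc n) x) ([:1, 2 * (x \<bullet> b), 1:] ^ Suc n)) s" for s
  proof -
    define v where "v = x + s *\<^sub>R b"
    have v2: "(norm v)\<^sup>2 = 1 + s * (2 * (x \<bullet> b)) + s\<^sup>2"
    proof -
      have "(norm v)\<^sup>2 = (norm x)\<^sup>2 + s * (2 * (x \<bullet> b)) + s\<^sup>2 * (norm b)\<^sup>2"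
        unfolding v_def power2_norm_eq_inner
        by (simp add: inner_add inner_commute power2_eq_square algebra_simps)
      then show ?thesis by (simp add: x b)
    qed
    \<comment> \<open>The squared modulus of \<open>herm v (sgn y)\<close> is quadratic in
      \<open>s\<close>, so its power is a polynomial in \<open>s\<close> of degree bounded
      independently of \<open>y\<close>. The case \<open>v = 0\<close> is included.\<close>
    have q: "A y + s * R y + s\<^sup>2 * B y = (norm v)\<^sup>2 * cos2 v y" for y
    proof -
      have "(cmod (herm v (sgn y)))\<^sup>2 = (norm v)\<^sup>2 * cos2 v y"
        by (cases "v = 0"; cases "y = 0")
           (auto simp: cos2_def hcos_def sgn_div_norm[of v] scaleR_eq_vector_scalar_mult herm_scale_left
              norm_mult norm_divide norm_inverse power_mult_distrib field_simps)
      moreover have "(cmod (herm v (sgn y)))\<^sup>2 = A y + s * R y + s\<^sup>2 * B y"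
        unfolding A_def B_def R_def v_def cmod_herm_sq
        by (simp add: inner_add_left power2_eq_square algebra_simps)
      ultimately show ?thesis by simp
    qed
    have "poly (P y) s = ((norm v)\<^sup>2) ^ Suc n * cos2 v y ^ Suc n" for y
      unfolding P_def poly_power power_mult_distrib[symmetric] q[symmetric]
      by (simp add: algebra_simps power2_eq_square)
    then have "(\<integral>y. poly (P y) s \<partial>fs_measure) = ((norm v)\<^sup>2) ^ Suc n * fs_moment (Suc n) v"
      by (simp add: fs_moment_def)
    also have "\<dots> = ((norm v)\<^sup>2) ^ Suc n * fs_moment (Suc n) x"
      using fs_moment_cong[of v x "Suc n"] x norm_zero[where 'a = "complex^'n"] by (cases "v = 0") fastforce+
    also have "\<dots> = poly (smult (fs_moment (Suc n) x) ([:1, 2 * (x \<bullet> b), 1:] ^ Suc n)) s"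
      unfolding v2 poly_smult poly_power by (simp add: algebra_simps power2_eq_square)
    finally show ?thesis .
  qed
  have "coeff (P y) 2 = real (Suc n) * A y ^ n * B y + real (Suc n) * real n / 2 * A y ^ (n - 1) * (R y)\<^sup>2" for y
    unfolding P_def by (rule coeff_quadratic_power)
  then show "integrable fs_measure (\<lambda>y. real (Suc n) * A y ^ n * B y + real (Suc n) * real n / 2 * A y ^ (n - 1) * (R y)\<^sup>2)"
    and "(\<integral>y. real (Suc n) * A y ^ n * B y + real (Suc n) * real n / 2 * A y ^ (n - 1) * (R y)\<^sup>2 \<partial>fs_measure)
      = fs_moment (Suc n) x * (real (Suc n) + 2 * real (Suc n) * real n * (x \<bullet> b)\<^sup>2)"
    using int[of 2] integral_poly_coeff[OF int deg eq, of 2]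
    by (simp_all only: coeff_quadratic_power coeff_smult power_one mult_1_right power_mult_distrib)
       (simp add: algebra_simps)
qed

text \<open>Summing the second variation over a real orthonormal basis amounts to taking the
  Laplacian of both sides. The integrand sums to \<open>2 * (Suc n)\<^sup>2 * A y ^ n\<close>, the
  right-hand side to \<open>2 * Suc n * (CARD('n) + n)\<close> times the moment of order
  \<open>Suc n\<close>.\<close>

lemma fs_moment_Suc:
  fixes x :: "complex^'n"
  assumes "x \<noteq> 0"
  shows "real (n + CARD('n)) * fs_moment (Suc n) x = real (Suc n) * fs_moment n x"
proof -
  define e where "e = sgn x"
  have e: "norm e = 1" "e \<noteq> 0" using assms by (auto simp: e_def norm_sgn sgn_zero_iff)
  define A where "A y = (cmod (herm e (sgn y)))\<^sup>2" for y
  define B where "B b y = (cmod (herm b (sgn y)))\<^sup>2" for b y :: "complex^'n"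
  define R where "R b y = 2 * ((e \<bullet> sgn y) * (b \<bullet> sgn y) + (e \<bullet> (\<i> *s sgn y)) * (b \<bullet> (\<i> *s sgn y)))" for b y
  define S where "S b y = real (Suc n) * A y ^ n * B b y + real (Suc n) * real n / 2 * A y ^ (n - 1) * (R b y)\<^sup>2" for b y
  have S: "integrable fs_measure (S b)" "(\<integral>y. S b y \<partial>fs_measure) = fs_moment (Suc n) e * (real (Suc n) + 2 * real (Suc n) * real n * (e \<bullet> b)\<^sup>2)"
    if "b \<in> Basis" for b
    using fs_moment_second_variation[OF e(1), of b n] that unfolding S_def[abs_def] A_def B_def R_def by simp_all
  have parseval: "(\<Sum>b\<in>Basis. (u \<bullet> b) * (v \<bullet> b)) = u \<bullet> v" for u v :: "complex^'n"
    by (rule euclidean_inner[symmetric])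
  \<comment> \<open>Each \<open>B b y\<close> is the sum of squared coordinates of
    \<open>sgn y\<close> and of \<open>\<i> *s sgn y\<close>, two unit vectors; Parseval gives 1 for
    each.\<close>
  have BS: "(\<Sum>b\<in>Basis. B b y) = 2" if "y \<noteq> 0" for y
  proof -
    have "(\<Sum>b\<in>Basis. B b y) = sgn y \<bullet> sgn y + (\<i> *s sgn y) \<bullet> (\<i> *s sgn y)"
      unfolding B_def cmod_herm_sq sum.distrib
      by (subst parseval[symmetric], subst parseval[symmetric]) (simp add: inner_commute power2_eq_square)
    also have "\<dots> = 2" using that by (simp add: inner_imaginary flip: power2_norm_eq_inner) (simp add: norm_sgn norm_vector_scalar_mult)
    finally show ?thesis .
  qed
  \<comment> \<open>\<open>R b y\<close> is twice a coordinate of the complex projection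
    \<open>w\<close> of \<open>e\<close> onto the line of \<open>y\<close>, and the squared norm of
    \<open>w\<close> is \<open>A y\<close>.\<close>
  have RS: "(\<Sum>b\<in>Basis. (R b y)\<^sup>2) = 4 * A y" if "y \<noteq> 0" for y
  proof -
    define p q where "p = e \<bullet> sgn y" and "q = e \<bullet> (\<i> *s sgn y)"
    define w where "w = p *\<^sub>R sgn y + q *\<^sub>R (\<i> *s sgn y)"
    have "R b y = 2 * (w \<bullet> b)" for b
      by (simp add: R_def p_def q_def w_def inner_add_left inner_commute[of b])
    then have "(\<Sum>b\<in>Basis. (R b y)\<^sup>2) = 4 * (w \<bullet> w)"
      by (subst parseval[symmetric]) (simp add: sum_distrib_left power2_eq_square algebra_simps)
    also have "w \<bullet> w = p\<^sup>2 * (sgn y \<bullet> sgn y) + q\<^sup>2 * (sgn y \<bullet> sgn y)"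
      by (simp add: w_def inner_add inner_imaginary inner_commute[of "\<i> *s sgn y" "sgn y"] power2_eq_square)
    also have "sgn y \<bullet> sgn y = 1" using that by (simp add: norm_sgn flip: power2_norm_eq_inner)
    finally show ?thesis by (simp add: A_def cmod_herm_sq p_def q_def)
  qed
  have "(\<Sum>b\<in>Basis. S b y) = 2 * (real (Suc n))\<^sup>2 * A y ^ n" if "y \<noteq> 0" for y
  proof -
    have "(\<Sum>b\<in>Basis. S b y) = real (Suc n) * A y ^ n * (\<Sum>b\<in>Basis. B b y)
        + real (Suc n) * real n / 2 * A y ^ (n - 1) * (\<Sum>b\<in>Basis. (R b y)\<^sup>2)"
      unfolding S_def sum.distrib sum_distrib_left ..
    also have "\<dots> = 2 * (real (Suc n))\<^sup>2 * A y ^ n"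
      unfolding BS[OF that] RS[OF that] by (cases n) (simp_all add: power2_eq_square algebra_simps)
    finally show ?thesis .
  qed
  then have "(\<integral>y. (\<Sum>b\<in>Basis. S b y) \<partial>fs_measure) = (\<integral>y. 2 * (real (Suc n))\<^sup>2 * A y ^ n \<partial>fs_measure)"
    using S(1) AE_fs_measure_nonzero by (intro integral_cong_AE) (auto simp: A_def[abs_def])
  also have "\<dots> = 2 * (real (Suc n))\<^sup>2 * fs_moment n e"
  proof -
    have "sgn e = e" by (simp add: sgn_div_norm e(1))
    then show ?thesis by (simp add: A_def fs_moment_def cos2_def hcos_def)
  qed
  finally have "2 * (real (Suc n))\<^sup>2 * fs_moment n e = (\<Sum>b\<in>Basis. \<integral>y. S b y \<partial>fs_measure)"
    using S(1) by (simp add: Bochner_Integration.integral_sum)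
  also have "\<dots> = fs_moment (Suc n) e * (real (Suc n) * real DIM(complex^'n) + 2 * real (Suc n) * real n * (\<Sum>b\<in>Basis. (e \<bullet> b)\<^sup>2))"
    by (simp add: S(2) sum.distrib sum_distrib_left algebra_simps)
  also have "(\<Sum>b\<in>Basis. (e \<bullet> b)\<^sup>2) = 1"
    using parseval[of e e] e(1) by (simp add: power2_eq_square flip: power2_norm_eq_inner)
  finally have "2 * real (Suc n) * (real (n + CARD('n)) * fs_moment (Suc n) e)
      = 2 * real (Suc n) * (real (Suc n) * fs_moment n e)"
    by (simp add: power2_eq_square algebra_simps)
  then have "real (n + CARD('n)) * fs_moment (Suc n) e = real (Suc n) * fs_moment n e"
    by (subst (asm) mult_cancel_left) simp
  then show ?thesis
    using fs_moment_cong[OF assms e(2)] by metis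
qed

text \<open>The reciprocal is the dimension of the space of homogeneous polynomials of degree
  \<open>k\<close> in \<open>d + 1\<close> variables, hence the number of points of the projective
  ensemble of that degree.\<close>

lemma fs_moment_eq:
  fixes x :: "complex^'n"
  assumes "x \<noteq> 0" "CARD('n) = Suc d"
  shows "fs_moment k x = 1 / real ((d + k) choose k)"
proof (induction k)
  case 0
  show ?case using fs.prob_space by (simp add: fs_moment_def)
next
  case (Suc k)
  have "real ((d + Suc k) choose Suc k) * real (Suc k) = real (k + CARD('n)) * real ((d + k) choose k)"
    using Suc_times_binomial_eq[of "d + k" k] assms(2)
    by (simp flip: of_nat_mult add: algebra_simps)
  moreover have "real (k + CARD('n)) * fs_moment (Suc k) x = real (Suc k) / real ((d + k) choose k)"
    using fs_moment_Suc[OF assms(1), of k] Suc.IH by simp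
  moreover have "real ((d + k) choose k) > 0" "real ((d + Suc k) choose Suc k) > 0" "real (k + CARD('n)) > 0"
    unfolding of_nat_0_less_iff by (auto intro: zero_less_binomial simp del: binomial_Suc_Suc)
  moreover have "m = 1 / a" if "a * s = N * b" "N * m = s / b" "b > 0" "a > 0" "N > 0" for a b N s m :: real
  proof -
    have "(N * b) * (a * m) = a * (N * m * b)" by simp
    also have "\<dots> = N * b" using that by simp
    finally show ?thesis using that by (simp add: field_simps)
  qed
  ultimately show ?case by blast
qed

section \<open>The Laplacian of powers of the squared cosine\<close>

lemma real_polynomial_function_has_derivative:
  fixes p :: "'a::euclidean_space \<Rightarrow> real"
  assumes "real_polynomial_function p"
  shows "\<exists>D. (\<forall>x. (p has_derivative D x) (at x)) \<and> (\<forall>b. real_polynomial_function (\<lambda>x. D x b))"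
  using assms
proof induction
  case (linear f)
  then show ?case
    by (intro exI[of _ "\<lambda>x. f"]) (auto intro: bounded_linear_imp_has_derivative real_polynomial_function.intros(2))
next
  case (const c)
  show ?case by (intro exI[of _ "\<lambda>x h. 0"]) (auto intro: real_polynomial_function.intros(2))
next
  case (add f g)
  then obtain D E where
    "\<And>x. (f has_derivative D x) (at x)" "\<And>b. real_polynomial_function (\<lambda>x. D x b)"
    "\<And>x. (g has_derivative E x) (at x)" "\<And>b. real_polynomial_function (\<lambda>x. E x b)" by metis
  then show ?case
    by (intro exI[of _ "\<lambda>x h. D x h + E x h"])
       (auto intro: has_derivative_add real_polynomial_function.intros(3))
next
  case (mult f g)
  then obtain D E where
    "\<And>x. (f has_derivative D x) (at x)" "\<And>b. real_polynomial_function (\<lambda>x. D x b)"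
    "\<And>x. (g has_derivative E x) (at x)" "\<And>b. real_polynomial_function (\<lambda>x. E x b)" by metis
  with mult show ?case
    by (intro exI[of _ "\<lambda>x h. f x * E x h + D x h * g x"])
       (auto intro!: has_derivative_mult real_polynomial_function.intros(3,4))
qed

text \<open>A class that contains the powers of \<open>cos2 y\<close> and is closed under
  directional derivatives, so that smoothness off the origin follows by induction on the list of
  directions.\<close>

definition rational_radial :: "('a::euclidean_space \<Rightarrow> real) \<Rightarrow> bool" where
  "rational_radial f \<longleftrightarrow>
     (\<exists>p m. real_polynomial_function p \<and> (\<forall>x. x \<noteq> 0 \<longrightarrow> f x = p x * inverse (x \<bullet> x) ^ m))"

lemma real_polynomial_function_inner:
  "real_polynomial_function (\<lambda>x::'a::euclidean_space. x \<bullet> b)"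
  by (intro real_polynomial_function.intros(1) bounded_linear_inner_left)

lemma real_polynomial_function_inner_self:
  "real_polynomial_function (\<lambda>x::'a::euclidean_space. x \<bullet> x)"
  unfolding euclidean_inner[of x x for x]
  by (intro real_polynomial_function_sum real_polynomial_function.intros(4) real_polynomial_function_inner) auto

lemma rational_radial_derivative:
  fixes f :: "'a::euclidean_space \<Rightarrow> real"
  assumes "rational_radial f"
  shows "x \<noteq> 0 \<Longrightarrow> f differentiable (at x)"
    and "rational_radial (\<lambda>x. frechet_derivative f (at x) b)"
proof -
  obtain p m where p: "real_polynomial_function p" "\<And>x. x \<noteq> 0 \<Longrightarrow> f x = p x * inverse (x \<bullet> x) ^ m"
    using assms unfolding rational_radial_def by blast
  obtain D where D: "\<And>x. (p has_derivative D x) (at x)" "\<And>b. real_polynomial_function (\<lambda>x. D x b)"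
    using real_polynomial_function_has_derivative[OF p(1)] by blast
  have der: "(f has_derivative (\<lambda>h. (D x h * (x \<bullet> x) - real m * (2 * (x \<bullet> h)) * p x) * inverse (x \<bullet> x) ^ Suc m)) (at x)"
    if x: "x \<noteq> 0" for x
  proof -
    have v: "((\<lambda>x. x \<bullet> x) has_derivative (\<lambda>h. 2 * (x \<bullet> h))) (at x)"
      by (auto intro!: derivative_eq_intros simp: inner_commute)
    define w where "w = inverse (x \<bullet> x)"
    have w: "(x \<bullet> x) * w = 1" using x by (simp add: w_def)
    have "((\<lambda>x. p x * inverse (x \<bullet> x) ^ m) has_derivative
        (\<lambda>h. p x * (real m * - (w * (2 * (x \<bullet> h)) * w) * w ^ (m - 1)) + D x h * w ^ m)) (at x)"
      unfolding w_def
      by (intro has_derivative_mult[OF D(1)] has_derivative_power Deriv.has_derivative_inverse[OF _ v]) (use x in simp)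
    moreover have "p x * (real m * - (w * (2 * (x \<bullet> h)) * w) * w ^ (m - 1)) + D x h * w ^ m
        = (D x h * (x \<bullet> x) - real m * (2 * (x \<bullet> h)) * p x) * w ^ Suc m" for h
    proof -
      have "D x h * w ^ m = D x h * ((x \<bullet> x) * w) * w ^ m" by (simp add: w)
      then show ?thesis by (cases m) (simp_all add: algebra_simps)
    qed
    ultimately have "((\<lambda>x. p x * inverse (x \<bullet> x) ^ m) has_derivative
        (\<lambda>h. (D x h * (x \<bullet> x) - real m * (2 * (x \<bullet> h)) * p x) * inverse (x \<bullet> x) ^ Suc m)) (at x)"
      unfolding w_def by simp
    then show ?thesis
      by (rule has_derivative_transform_within_open[of _ _ _ UNIV "- {0}"]) (use x p(2) in auto)
  qed
  show "f differentiable (at x)" if "x \<noteq> 0"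
    using der[OF that] by (rule differentiableI)
  have "frechet_derivative f (at x) b = (D x b * (x \<bullet> x) - real m * (2 * (x \<bullet> b)) * p x) * inverse (x \<bullet> x) ^ Suc m"
    if "x \<noteq> 0" for x
    by (rule fun_cong[OF frechet_derivative_at[OF der[OF that]], symmetric])
  moreover have "real_polynomial_function (\<lambda>x. D x b * (x \<bullet> x) - real m * (2 * (x \<bullet> b)) * p x)"
    by (intro real_polynomial_function_diff real_polynomial_function.intros(4) D(2) p(1)
          real_polynomial_function_inner real_polynomial_function_inner_self real_polynomial_function.intros(2))
  ultimately show "rational_radial (\<lambda>x. frechet_derivative f (at x) b)"
    unfolding rational_radial_def by blast
qed

lemma smooth_on_rational_radial:
  assumes "rational_radial F"
  shows "smooth_on (- {0}) F"
proof -
  have "rational_radial (iter_deriv bs F)" for bs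
    by (induction bs) (simp_all add: assms rational_radial_derivative(2))
  then show ?thesis
    unfolding smooth_on_def by (auto intro: rational_radial_derivative(1))
qed

lemma cos2_inner:
  "cos2 y z = ((z \<bullet> sgn y)\<^sup>2 + (z \<bullet> (\<i> *s sgn y))\<^sup>2) / (z \<bullet> z)"
proof -
  have "cos2 y z = cos2 z (sgn y)"
    by (simp add: cos2_commute[of y z]) (simp add: cos2_def hcos_def sgn_div_norm[of "sgn y"] norm_sgn)
  also have "\<dots> = (cmod (herm z (sgn y)))\<^sup>2 / (z \<bullet> z)"
    by (cases "y = 0") (simp_all add: cos2_eq norm_sgn power2_norm_eq_inner)
  finally show ?thesis by (simp add: cmod_herm_sq)
qed

lemma FS_test_cos2_power: "FS_test (\<lambda>z. cos2 y z ^ k)"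
proof -
  have "rational_radial (\<lambda>z. cos2 y z ^ k)"
    unfolding rational_radial_def cos2_inner divide_inverse power_mult_distrib
    by (intro exI[of _ "\<lambda>z. ((z \<bullet> sgn y)\<^sup>2 + (z \<bullet> (\<i> *s sgn y))\<^sup>2) ^ k"] exI[of _ k] conjI
          real_polynomial_function_power real_polynomial_function.intros(3) real_polynomial_function_inner) simp
  then show ?thesis
    unfolding FS_test_def by (auto intro: smooth_on_rational_radial simp: cos2_scale_right)
qed

text \<open>Chain rule for a power of t = \<open>cos2 y\<close>, using that, with v the squared norm
  of \<open>x\<close>, the squared gradient of t at \<open>x\<close> is 4 t (1 - t) / v and its
  Laplacian is 4 (1 - \<open>CARD('n)\<close> t) / v.\<close>

lemma eucl_laplacian_cos2_power:
  fixes x y :: "complex^'n"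
  assumes x: "x \<noteq> 0" and y: "y \<noteq> 0"
  shows "(norm x)\<^sup>2 * eucl_laplacian (\<lambda>z. cos2 y z ^ Suc m) x =
    4 * (real (Suc m))\<^sup>2 * cos2 y x ^ m - 4 * real (Suc m) * real (m + CARD('n)) * cos2 y x ^ Suc m"
proof -
  define e f where "e = sgn y" and "f = \<i> *s sgn y"
  have ef: "e \<bullet> e = 1" "f \<bullet> f = 1" "e \<bullet> f = 0" "f \<bullet> e = 0"
    using y by (auto simp: e_def f_def inner_imaginary inner_commute[of "\<i> *s sgn y" "sgn y"] norm_sgn simp flip: power2_norm_eq_inner)
       (simp add: norm_vector_scalar_mult norm_sgn)
  define t where "t z = ((z \<bullet> e)\<^sup>2 + (z \<bullet> f)\<^sup>2) / (z \<bullet> z)" for z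
  have t: "cos2 y = t" by (simp add: fun_eq_iff cos2_inner t_def e_def f_def)
  \<comment> \<open>The Euclidean gradient of \<open>t\<close>.\<close>
  define W where "W z = (2 / (z \<bullet> z)) *\<^sub>R ((z \<bullet> e) *\<^sub>R e + (z \<bullet> f) *\<^sub>R f - t z *\<^sub>R z)" for z
  have norm2: "((\<lambda>z. z \<bullet> z) has_derivative (\<lambda>h. 2 * (z \<bullet> h))) (at z)" for z :: "complex^'n"
    by (auto intro!: derivative_eq_intros simp: inner_commute)
  have inner_W: "h \<bullet> W z = 2 / (z \<bullet> z) * ((z \<bullet> e) * (h \<bullet> e) + (z \<bullet> f) * (h \<bullet> f) - t z * (z \<bullet> h))" for h z
    by (simp add: W_def inner_diff_right inner_add_right inner_commute)
  have Dt: "(t has_derivative (\<lambda>h. h \<bullet> W z)) (at z)" if "z \<noteq> 0" for z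
  proof -
    have u: "((\<lambda>z. (z \<bullet> e)\<^sup>2 + (z \<bullet> f)\<^sup>2) has_derivative
        (\<lambda>h. 2 * ((z \<bullet> e) * (h \<bullet> e) + (z \<bullet> f) * (h \<bullet> f)))) (at z)"
      by (auto intro!: derivative_eq_intros simp: algebra_simps)
    have zz: "z \<bullet> z \<noteq> 0" using that by simp
    have eq: "(2 * a * v - u * (2 * c)) / (v * v) = 2 / v * (a - u / v * c)" if "v \<noteq> 0" for a v u c :: real
      using that by (simp add: field_simps)
    show ?thesis
      unfolding t_def[abs_def]
      by (rule has_derivative_eq_rhs[OF has_derivative_divide'[OF u norm2 zz]])
         (rule ext, simp only: inner_W t_def eq[OF zz])
  qed
  have D1: "iter_deriv [h] (\<lambda>z. t z ^ Suc m) z = real (Suc m) * t z ^ m * (h \<bullet> W z)" if "z \<noteq> 0" for z h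
  proof -
    have "((\<lambda>z. t z ^ Suc m) has_derivative (\<lambda>h. real (Suc m) * t z ^ m * (h \<bullet> W z))) (at z)"
      by (rule has_derivative_eq_rhs[OF has_derivative_power[OF Dt[OF that]]])
         (simp add: fun_eq_iff algebra_simps)
    from fun_cong[OF frechet_derivative_at[OF this], of h] show ?thesis by simp
  qed
  define v where "v = x \<bullet> x"
  have v: "v > 0" using x by (simp add: v_def)
  define T where "T = t x"
  have Tv: "(x \<bullet> e)\<^sup>2 + (x \<bullet> f)\<^sup>2 = T * v" using v by (simp add: T_def t_def v_def)
  have DW: "((\<lambda>z. h \<bullet> W z) has_derivative (\<lambda>k. 2 / v * ((k \<bullet> e) * (h \<bullet> e) + (k \<bullet> f) * (h \<bullet> f)
      - (k \<bullet> W x) * (x \<bullet> h) - T * (k \<bullet> h) - (x \<bullet> k) * (h \<bullet> W x)))) (at x)" for h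
  proof -
    have "((\<lambda>z. 2 / (z \<bullet> z) * ((z \<bullet> e) * (h \<bullet> e) + (z \<bullet> f) * (h \<bullet> f) - t z * (z \<bullet> h)))
        has_derivative (\<lambda>k. 2 / v * ((k \<bullet> e) * (h \<bullet> e) + (k \<bullet> f) * (h \<bullet> f)
          - (k \<bullet> W x) * (x \<bullet> h) - T * (k \<bullet> h) - (x \<bullet> k) * (h \<bullet> W x)))) (at x)"
    proof -
      have num: "((\<lambda>z. (z \<bullet> e) * (h \<bullet> e) + (z \<bullet> f) * (h \<bullet> f) - t z * (z \<bullet> h)) has_derivative
          (\<lambda>k. (k \<bullet> e) * (h \<bullet> e) + (k \<bullet> f) * (h \<bullet> f) - (t x * (k \<bullet> h) + (k \<bullet> W x) * (x \<bullet> h)))) (at x)"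
        by (intro has_derivative_diff has_derivative_add has_derivative_mult[OF Dt[OF x]]
              has_derivative_mult_left has_derivative_inner_left has_derivative_ident)
      have den: "((\<lambda>z. 2 / (z \<bullet> z)) has_derivative (\<lambda>k. - 2 * (2 * (x \<bullet> k)) / (v * v))) (at x)"
        using has_derivative_divide'[OF has_derivative_const[of 2] norm2[of x]] x by (simp add: v_def)
      \<comment> \<open>Differentiating the prefactor 2 / v leaves a multiple of
        \<open>h \<bullet> W x\<close> itself; this is the last term of the claimed
        derivative.\<close>
      have eq: "2 / v * (a - (T * b + c)) + - 2 * (2 * p) / (v * v) * N = 2 / v * (a - c - T * b - p * (2 / v * N))" for a b c p N
        using v by (simp add: field_simps)
      show ?thesis
        by (rule has_derivative_eq_rhs[OF has_derivative_mult[OF den num]])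
           (rule ext, simp only: inner_W[of h x] v_def[symmetric] T_def[symmetric] eq)
    qed
    then show ?thesis
      by (simp only: inner_W)
  qed
  have D2: "iter_deriv [h, h] (\<lambda>z. t z ^ Suc m) x = real (Suc m) * (real m * T ^ (m - 1) * (h \<bullet> W x)\<^sup>2
      + T ^ m * (2 / v * ((h \<bullet> e)\<^sup>2 + (h \<bullet> f)\<^sup>2 - T * (h \<bullet> h) - 2 * ((x \<bullet> h) * (h \<bullet> W x)))))" for h
  proof -
    have "((\<lambda>z. real (Suc m) * t z ^ m * (h \<bullet> W z)) has_derivative
       (\<lambda>k. real (Suc m) * (real m * T ^ (m - 1) * (k \<bullet> W x) * (h \<bullet> W x)
      + T ^ m * (2 / v * ((k \<bullet> e) * (h \<bullet> e) + (k \<bullet> f) * (h \<bullet> f)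
          - (k \<bullet> W x) * (x \<bullet> h) - T * (k \<bullet> h) - (x \<bullet> k) * (h \<bullet> W x)))))) (at x)"
      by (rule has_derivative_eq_rhs[OF has_derivative_mult[OF has_derivative_mult_right[OF has_derivative_power[OF Dt[OF x]]] DW]])
         (simp add: fun_eq_iff algebra_simps T_def)
    then have "((\<lambda>z. iter_deriv [h] (\<lambda>z. t z ^ Suc m) z) has_derivative
       (\<lambda>k. real (Suc m) * (real m * T ^ (m - 1) * (k \<bullet> W x) * (h \<bullet> W x)
      + T ^ m * (2 / v * ((k \<bullet> e) * (h \<bullet> e) + (k \<bullet> f) * (h \<bullet> f)
          - (k \<bullet> W x) * (x \<bullet> h) - T * (k \<bullet> h) - (x \<bullet> k) * (h \<bullet> W x)))))) (at x)"
      by (rule has_derivative_transform_within_open[of _ _ _ UNIV "- {0}"]) (use x D1 in auto)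
    from fun_cong[OF frechet_derivative_at[OF this], of h, symmetric] show ?thesis
      by (simp add: power2_eq_square algebra_simps)
  qed
  have parseval: "(\<Sum>b\<in>Basis. (b \<bullet> p) * (b \<bullet> q)) = p \<bullet> q" for p q :: "complex^'n"
    by (subst euclidean_inner[of p q]) (simp add: inner_commute)
  have "(\<Sum>b\<in>Basis. (b \<bullet> W x)\<^sup>2) = W x \<bullet> W x"
    by (simp add: power2_eq_square parseval)
  also have "\<dots> = (2 / v)\<^sup>2 * ((x \<bullet> e)\<^sup>2 + (x \<bullet> f)\<^sup>2 - 2 * T * ((x \<bullet> e)\<^sup>2 + (x \<bullet> f)\<^sup>2) + T\<^sup>2 * v)"
    unfolding W_def v_def[symmetric] T_def[symmetric]
    by (simp add: inner_diff inner_add ef v_def[symmetric] inner_commute[of e x] inner_commute[of f x] power2_eq_square algebra_simps)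
  also have "\<dots> = 4 * T * (1 - T) / v"
    unfolding Tv using v by (simp add: field_simps power2_eq_square)
  finally have S1: "(\<Sum>b\<in>Basis. (b \<bullet> W x)\<^sup>2) = 4 * T * (1 - T) / v" .
  have S2: "(\<Sum>b\<in>Basis. (b \<bullet> e)\<^sup>2) = 1" "(\<Sum>b\<in>Basis. (b \<bullet> f)\<^sup>2) = 1"
    by (simp_all add: power2_eq_square parseval ef)
  \<comment> \<open>By Euler's relation: \<open>t\<close> is homogeneous of degree 0, so its radial
    derivative vanishes.\<close>
  have "(\<Sum>b\<in>Basis. (x \<bullet> b) * (b \<bullet> W x)) = x \<bullet> W x"
    using parseval[of x "W x"] by (simp add: inner_commute)
  also have "\<dots> = 2 / v * ((x \<bullet> e)\<^sup>2 + (x \<bullet> f)\<^sup>2 - T * v)"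
    unfolding W_def v_def[symmetric] T_def[symmetric]
    by (simp add: inner_diff_right inner_add_right v_def[symmetric] power2_eq_square)
  finally have S3: "(\<Sum>b\<in>Basis. (x \<bullet> b) * (b \<bullet> W x)) = 0" unfolding Tv by simp
  have S4: "(\<Sum>b\<in>(Basis :: (complex^'n) set). b \<bullet> b) = 2 * real CARD('n)"
    by simp
  have "eucl_laplacian (\<lambda>z. cos2 y z ^ Suc m) x = real (Suc m) * (real m * T ^ (m - 1) * (\<Sum>b\<in>Basis. (b \<bullet> W x)\<^sup>2)
      + T ^ m * (2 / v * ((\<Sum>b\<in>Basis. (b \<bullet> e)\<^sup>2) + (\<Sum>b\<in>Basis. (b \<bullet> f)\<^sup>2)
        - T * (\<Sum>b\<in>(Basis :: (complex^'n) set). b \<bullet> b) - 2 * (\<Sum>b\<in>Basis. (x \<bullet> b) * (b \<bullet> W x)))))"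
    unfolding eucl_laplacian_def t D2 
    by (simp only: sum_distrib_left[symmetric] sum.distrib sum_subtractf)
  also have "\<dots> = real (Suc m) * (real m * T ^ (m - 1) * (4 * T * (1 - T) / v) + T ^ m * (2 / v * (2 - 2 * real CARD('n) * T)))"
    unfolding S1 S2 S3 S4 by (simp add: algebra_simps)
  finally have L: "eucl_laplacian (\<lambda>z. cos2 y z ^ Suc m) x = real (Suc m) *
      (real m * T ^ (m - 1) * (4 * T * (1 - T) / v) + T ^ m * (2 / v * (2 - 2 * real CARD('n) * T)))" .
  have "(norm x)\<^sup>2 = v" by (simp add: v_def power2_norm_eq_inner)
  then show ?thesis
    unfolding L unfolding t T_def[symmetric] using v
    by (cases m) (simp_all add: field_simps power2_eq_square)
qed

lemma FS_laplacian_cos2_power: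
  fixes x y :: "complex^'n"
  assumes "x \<noteq> 0" "y \<noteq> 0"
  shows "FS_laplacian (\<lambda>z. cos2 y z ^ Suc m) x =
    4 * real (Suc m) * real (m + CARD('n)) * cos2 y x ^ Suc m - 4 * (real (Suc m))\<^sup>2 * cos2 y x ^ m"
  unfolding FS_laplacian_def eucl_laplacian_cos2_power[OF assms] by simp

section \<open>Means of the Green function\<close>

lemma FS_volume_pos: "FS_volume TYPE('n::finite) > 0"
  by (simp add: FS_volume_def)

text \<open>At \<open>t = cos2 y x\<close> this is the volume times the mean of \<open>G x\<close>
  under the probability density proportional to \<open>cos2 y z ^ k\<close>. The summands are the
  increments of the solved recursion; their denominators contain the Laplace eigenvalues 4 j (j +
  d).\<close>

definition green_mean :: "nat \<Rightarrow> nat \<Rightarrow> real \<Rightarrow> real" where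
  "green_mean d k t = (\<Sum>j=1..k. (real ((d + j) choose j) * t ^ j - 1) / (4 * real j * real (j + d)))"

text \<open>After dropping the nonnegative terms with powers of \<open>t\<close>, the sum of 1 / (4
  j (j + d)) is compared with that of 1 / (4 j (j + 1)), which telescopes to (1 - 1 / (k + 1)) /
  4.\<close>

lemma green_mean_ge:
  assumes "d \<ge> 1" "t \<ge> 0"
  shows "green_mean d k t \<ge> - 1 / 4"
proof -
  have "- (1 - 1 / real (Suc k)) / 4 \<le> green_mean d k t"
  proof (induction k)
    case (Suc k)
    have "1 / (a + 1) = 1 / a - 1 / (a * (a + 1))" if "a > 0" for a :: real
      using that add_pos_pos[of a "a * a"] by (simp add: field_simps)
    from this[of "real (Suc k)"]
    have "- (1 - 1 / real (Suc (Suc k))) / 4 = - (1 - 1 / real (Suc k)) / 4 - 1 / (real (Suc k) * real (Suc k + 1)) / 4"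
      by (simp add: add.commute diff_divide_distrib)
    also have "\<dots> \<le> green_mean d k t + (- 1) / (4 * real (Suc k) * real (Suc k + d))"
    proof -
      have 1: "1 / (real (Suc k) * real (Suc k + d)) / 4 \<le> 1 / (real (Suc k) * real (Suc k + 1)) / 4"
        using assms(1) by (intro divide_right_mono divide_left_mono mult_left_mono) auto
      have 2: "(- 1) / (4 * real (Suc k) * real (Suc k + d)) = - (1 / (real (Suc k) * real (Suc k + d)) / 4)"
        by simp
      show ?thesis
        unfolding 2 using add_mono[OF Suc.IH le_imp_neg_le[OF 1]] by (simp only: diff_conv_add_uminus)
    qed
    also have "\<dots> \<le> green_mean d k t + (real ((d + Suc k) choose Suc k) * t ^ Suc k - 1) / (4 * real (Suc k) * real (Suc k + d))"
      using assms(2) by (intro add_left_mono divide_right_mono) auto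
    also have "\<dots> = green_mean d (Suc k) t" by (simp add: green_mean_def)
    finally show ?case .
  qed (simp add: green_mean_def)
  moreover have "- 1 / 4 \<le> - (1 - 1 / real (Suc k)) / 4" by simp
  ultimately show ?thesis by (rule order_trans[rotated])
qed

lemma proj_eq_commute:
  fixes x y :: "complex^'n"
  shows "x \<noteq> 0 \<Longrightarrow> y \<noteq> 0 \<Longrightarrow> proj_eq x y \<longleftrightarrow> proj_eq y x"
  by (simp add: proj_eq_iff cmod_herm_commute[of y x] mult.commute)

locale fs_green =
  fixes G :: "complex^'n \<Rightarrow> complex^'n \<Rightarrow> ereal" and d :: nat
  assumes card: "CARD('n) = d + 1" and d: "d \<ge> 1" and green: "is_FS_green G"
begin

text \<open>\<open>is_FS_green\<close> leaves \<open>G\<close> unconstrained at the zero vector; the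
  value 0 there and on the diagonal makes \<open>g\<close> real-valued, symmetric and jointly Borel,
  and for fixed nonzero \<open>x\<close> changes nothing in the integrals.\<close>

definition g :: "complex^'n \<Rightarrow> complex^'n \<Rightarrow> real" where
  "g x z = (if x \<noteq> 0 \<and> z \<noteq> 0 \<and> \<not> proj_eq x z then real_of_ereal (G x z) else 0)"

lemma V_pos: "FS_volume TYPE('n) > 0"
  by (rule FS_volume_pos)

lemma G_commute: "x \<noteq> 0 \<Longrightarrow> y \<noteq> 0 \<Longrightarrow> G x y = G y x"
  using green unfolding is_FS_green_def by blast

lemma G_finite: "x \<noteq> 0 \<Longrightarrow> y \<noteq> 0 \<Longrightarrow> \<not> proj_eq x y \<Longrightarrow> \<bar>G x y\<bar> \<noteq> \<infinity>"
  using green unfolding is_FS_green_def by auto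

lemma g_commute: "g x y = g y x"
  unfolding g_def using G_commute[of x y] proj_eq_commute[of x y] by auto

lemma g_scale:
  assumes c: "c \<noteq> 0"
  shows "g x (c *s z) = g x z"
proof (cases "x = 0 \<or> z = 0")
  case False
  have cz: "c *s z \<noteq> 0" using c False by (simp add: vec_eq_iff)
  have "G (c *s z) x = G z x"
    using green c False unfolding is_FS_green_def by blast
  then have "G x (c *s z) = G x z"
    using G_commute[of x z] G_commute[of x "c *s z"] cz False by simp
  moreover have "proj_eq x (c *s z) \<longleftrightarrow> proj_eq x z"
    using cz False c
    by (simp add: proj_eq_iff herm_scale_right norm_mult norm_vector_scalar_mult power_mult_distrib)
  ultimately show ?thesis using cz False by (simp add: g_def)
qed (auto simp: g_def)

definition offdiag :: "((complex^'n) \<times> (complex^'n)) set" where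
  "offdiag = {(x, y). x \<noteq> 0 \<and> y \<noteq> 0 \<and> \<not> proj_eq x y}"

lemma open_offdiag: "open offdiag"
proof -
  have "offdiag = {p. fst p \<noteq> 0} \<inter> {p. snd p \<noteq> 0}
      \<inter> {p. (cmod (herm (fst p) (snd p)))\<^sup>2 \<noteq> (norm (fst p))\<^sup>2 * (norm (snd p))\<^sup>2}"
    by (auto simp: offdiag_def proj_eq_iff)
  also have "open \<dots>"
    unfolding herm_def by (intro open_Int open_Collect_neq continuous_intros)
  finally show ?thesis .
qed

lemma continuous_on_g: "continuous_on offdiag (\<lambda>(x, y). g x y)"
proof -
  have "continuous_on offdiag (\<lambda>(x, y). real_of_ereal (G x y))"
    using green unfolding is_FS_green_def offdiag_def by blast
  then show ?thesis
    by (rule continuous_on_eq) (auto simp: offdiag_def g_def)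
qed

lemma measurable_g: "(\<lambda>(x, y). g x y) \<in> borel_measurable (borel \<Otimes>\<^sub>M borel)"
proof -
  have "(\<lambda>p. indicator offdiag p *\<^sub>R (case p of (x, y) \<Rightarrow> g x y)) \<in> borel_measurable borel"
    by (rule borel_measurable_continuous_on_indicator[OF _ continuous_on_g])
       (use open_offdiag in simp)
  also have "(\<lambda>p. indicator offdiag p *\<^sub>R (case p of (x, y) \<Rightarrow> g x y)) = (\<lambda>(x, y). g x y)"
    by (auto simp: fun_eq_iff indicator_def offdiag_def g_def)
  finally show ?thesis by (simp add: borel_prod)
qed

lemma measurable_g_right [measurable]: "g x \<in> borel_measurable borel"
  using measurable_compose[OF measurable_Pair1'[of x borel borel] measurable_g] by simp

lemma AE_g_eq:
  assumes x: "x \<noteq> 0"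
  shows "AE z in fs_measure. g x z = real_of_ereal (G x z)"
proof -
  have "AE z in fs_measure. \<not> proj_eq x z"
    using AE_not_proj_eq[OF x] card d by simp
  then show ?thesis
    using AE_fs_measure_nonzero by eventually_elim (simp add: g_def x)
qed

lemma
  assumes x: "x \<noteq> 0"
  shows integrable_g: "integrable fs_measure (g x)" and integral_g: "(\<integral>z. g x z \<partial>fs_measure) = 0"
proof -
  have "FS_integrable (\<lambda>z. real_of_ereal (G x z))" and 0: "FS_integral (\<lambda>z. real_of_ereal (G x z)) = 0"
    using green x unfolding is_FS_green_def by blast+
  note G = FS_integrableD[OF this(1)]
  show "integrable fs_measure (g x)"
    using G AE_g_eq[OF x] by (subst integrable_cong_AE[of _ _ "\<lambda>z. real_of_ereal (G x z)"]) auto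
  have "(\<integral>z. g x z \<partial>fs_measure) = (\<integral>z. real_of_ereal (G x z) \<partial>fs_measure)"
    using G AE_g_eq[OF x] by (intro integral_cong_AE) auto
  then show "(\<integral>z. g x z \<partial>fs_measure) = 0"
    using 0 V_pos FS_integral_eq[OF G(1)] by simp
qed

lemma integrable_g_cos2:
  assumes x: "x \<noteq> 0"
  shows "integrable fs_measure (\<lambda>z. g x z * cos2 y z ^ k)"
  by (rule integrable_mult_bounded[OF integrable_g[OF x], where B = 1]) (auto simp: power_le_one)

lemma green_identity:
  fixes x y :: "complex^'n"
  assumes x: "x \<noteq> 0" and y: "y \<noteq> 0"
  shows "FS_volume TYPE('n) * (4 * real (Suc k) * real (Suc k + d) * (\<integral>z. g x z * cos2 y z ^ Suc k \<partial>fs_measure)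
      - 4 * (real (Suc k))\<^sup>2 * (\<integral>z. g x z * cos2 y z ^ k \<partial>fs_measure))
    = cos2 y x ^ Suc k - fs_moment (Suc k) y"
proof -
  define \<phi> where "\<phi> z = cos2 y z ^ Suc k" for z
  \<comment> \<open>The Laplacian of the lift carries the factor \<open>(norm z)\<^sup>2\<close> and
    so is 0 at the origin, where the formula in \<open>cos2\<close> fails in general.\<close>
  define \<psi> where "\<psi> z = (if z = 0 then 0 else
    4 * real (Suc k) * real (Suc k + d) * cos2 y z ^ Suc k - 4 * (real (Suc k))\<^sup>2 * cos2 y z ^ k)" for z
  have \<psi>: "FS_laplacian \<phi> = \<psi>"
    using FS_laplacian_cos2_power[OF _ y, of _ k]
    by (auto simp: fun_eq_iff \<psi>_def \<phi>_def[abs_def] card FS_laplacian_def)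
  have "FS_integrable (\<lambda>z. real_of_ereal (G x z))"
    using green x unfolding is_FS_green_def by blast
  note G = FS_integrableD[OF this]
  have \<phi>: "FS_test \<phi>" unfolding \<phi>_def[abs_def] by (rule FS_test_cos2_power)
  have [measurable]: "\<psi> \<in> borel_measurable borel" unfolding \<psi>_def[abs_def] by measurable
  have [measurable]: "\<phi> \<in> borel_measurable borel" unfolding \<phi>_def[abs_def] by measurable
  have [measurable]: "(\<lambda>z. real_of_ereal (G x z)) \<in> borel_measurable borel" by (rule G(1))
  have "FS_integral (\<lambda>z. real_of_ereal (G x z) * FS_laplacian \<phi> z) = \<phi> x - FS_integral \<phi> / FS_volume TYPE('n)"
    using green x \<phi> unfolding is_FS_green_def by blast
  then have "FS_volume TYPE('n) * (\<integral>z. real_of_ereal (G x z) * \<psi> z \<partial>fs_measure) = \<phi> x - (\<integral>z. \<phi> z \<partial>fs_measure)"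
    unfolding \<psi> using V_pos by (simp add: FS_integral_eq)
  also have "(\<integral>z. real_of_ereal (G x z) * \<psi> z \<partial>fs_measure)
      = (\<integral>z. 4 * real (Suc k) * real (Suc k + d) * (g x z * cos2 y z ^ Suc k)
          - 4 * (real (Suc k))\<^sup>2 * (g x z * cos2 y z ^ k) \<partial>fs_measure)"
  proof (rule integral_cong_AE)
    show "AE z in fs_measure. real_of_ereal (G x z) * \<psi> z = 4 * real (Suc k) * real (Suc k + d) * (g x z * cos2 y z ^ Suc k)
          - 4 * (real (Suc k))\<^sup>2 * (g x z * cos2 y z ^ k)"
      using AE_g_eq[OF x] AE_fs_measure_nonzero
      by eventually_elim (simp add: \<psi>_def right_diff_distrib mult_ac del: power_Suc of_nat_Suc)
  qed simp_all
  also have "\<dots> = 4 * real (Suc k) * real (Suc k + d) * (\<integral>z. g x z * cos2 y z ^ Suc k \<partial>fs_measure)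
      - 4 * (real (Suc k))\<^sup>2 * (\<integral>z. g x z * cos2 y z ^ k \<partial>fs_measure)"
    using integrable_g_cos2[OF x, of y k] integrable_g_cos2[OF x, of y "Suc k"]
    by (simp del: power_Suc of_nat_Suc)
  finally show ?thesis unfolding \<phi>_def fs_moment_def .
qed

text \<open>The binomial factor normalizes the kernel and satisfies
  \<open>C (Suc k) * s = N * C k\<close>, so that multiplying the recursion by it cancels the ratio
  of its coefficients and leaves a plain summation.\<close>

lemma integral_g_cos2:
  fixes x y :: "complex^'n"
  assumes x: "x \<noteq> 0" and y: "y \<noteq> 0"
  shows "FS_volume TYPE('n) * (\<integral>z. g x z * cos2 y z ^ k \<partial>fs_measure) * real ((d + k) choose k) = green_mean d k (cos2 y x)"
proof (induction k)
  case 0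
  show ?case using integral_g[OF x] by (simp add: green_mean_def)
next
  case (Suc k)
  define I where "I k = (\<integral>z. g x z * cos2 y z ^ k \<partial>fs_measure)" for k
  define C where "C k = real ((d + k) choose k)" for k
  define s N where "s = real (Suc k)" and "N = real (Suc k + d)"
  have pos: "s > 0" "N > 0" "C k > 0" "C (Suc k) > 0"
    unfolding s_def N_def C_def of_nat_0_less_iff by (auto intro: zero_less_binomial simp del: binomial_Suc_Suc)
  have C: "C (Suc k) * s = N * C k"
    using Suc_times_binomial_eq[of "d + k" k] unfolding C_def s_def N_def
    by (simp flip: of_nat_mult add: algebra_simps)
  have m: "fs_moment (Suc k) y = 1 / C (Suc k)"
    unfolding C_def by (rule fs_moment_eq[OF y]) (simp add: card)
  have "FS_volume TYPE('n) * (4 * s * N * I (Suc k) - 4 * s\<^sup>2 * I k) = cos2 y x ^ Suc k - 1 / C (Suc k)"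
    using green_identity[OF x y, of k] unfolding I_def s_def N_def m[symmetric] .
  then have *: "4 * s * N * (FS_volume TYPE('n) * I (Suc k)) = 4 * s\<^sup>2 * (FS_volume TYPE('n) * I k) + cos2 y x ^ Suc k - 1 / C (Suc k)"
    by (simp add: algebra_simps)
  have "4 * s * N * (FS_volume TYPE('n) * I (Suc k) * C (Suc k)) = (4 * s * N * (FS_volume TYPE('n) * I (Suc k))) * C (Suc k)"
    by simp
  also have "\<dots> = 4 * s * (FS_volume TYPE('n) * I k) * (C (Suc k) * s) + (cos2 y x ^ Suc k - 1 / C (Suc k)) * C (Suc k)"
    unfolding * by (simp add: power2_eq_square algebra_simps)
  also have "\<dots> = 4 * s * N * (FS_volume TYPE('n) * I k * C k) + (C (Suc k) * cos2 y x ^ Suc k - 1)"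
    unfolding C using pos by (simp add: field_simps)
  finally have "FS_volume TYPE('n) * I (Suc k) * C (Suc k) = FS_volume TYPE('n) * I k * C k + (C (Suc k) * cos2 y x ^ Suc k - 1) / (4 * s * N)"
    using pos by (simp add: field_simps)
  also have "FS_volume TYPE('n) * I k * C k = green_mean d k (cos2 y x)" using Suc.IH unfolding I_def C_def .
  finally show ?case
    unfolding I_def C_def s_def N_def by (simp add: green_mean_def del: binomial_Suc_Suc of_nat_Suc power_Suc)
qed

text \<open>If \<open>g x\<close> were smaller near \<open>y\<close>, then its means against the kernels \<open>cos2 y z ^ N\<close>,
  which concentrate near \<open>y\<close> as \<open>N\<close> grows, would violate \<open>green_mean_ge\<close>.\<close>

lemma g_lower_bound: "g x y \<ge> - 1 / (4 * FS_volume TYPE('n))"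
proof (cases "x \<noteq> 0 \<and> y \<noteq> 0 \<and> \<not> proj_eq x y")
  case False
  then have "g x y = 0" by (simp only: g_def if_False)
  then show ?thesis using V_pos by simp
next
  case True
  then have x: "x \<noteq> 0" and y: "y \<noteq> 0" and xy: "(x, y) \<in> offdiag" by (auto simp: offdiag_def)
  define h where "h z = g x z + 1 / (4 * FS_volume TYPE('n))" for z
  show ?thesis
  proof (rule ccontr)
    assume "\<not> ?thesis"
    then have hy: "h y < 0" by (simp add: h_def)
    define \<epsilon> where "\<epsilon> = - h y / 2"
    have \<epsilon>: "\<epsilon> > 0" "h y < - \<epsilon>" using hy by (simp_all add: \<epsilon>_def)
    have "isCont (\<lambda>(x, y). g x y) (x, y)"
      using continuous_on_g open_offdiag xy by (simp add: continuous_on_eq_continuous_at)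
    then have "isCont (\<lambda>z. (\<lambda>(x, y). g x y) (x, z)) y"
      by (intro isCont_o2[where g = "\<lambda>(x, y). g x y" and f = "Pair x"] continuous_intros) auto
    then have "isCont h y"
      unfolding h_def by (intro continuous_intros) simp
    then have "eventually (\<lambda>z. h z < - \<epsilon>) (nhds y)"
      using \<epsilon>(2) by (intro order_tendstoD(2)[of h "h y"]) (simp_all add: isCont_def tendsto_nhds_iff)
    then obtain \<rho> where \<rho>: "\<rho> > 0" "\<And>z. dist z y < \<rho> \<Longrightarrow> h z < - \<epsilon>"
      unfolding eventually_nhds_metric by blast
    \<comment> \<open>Where \<open>cos2 y z > q\<close>, the projection of \<open>y\<close> to the
      line of \<open>z\<close> lies within \<open>\<rho>\<close> of \<open>y\<close>, the squared
      distance being \<open>(norm y)\<^sup>2 * (1 - cos2 y z)\<close>. The maximum with 1/2 keeps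
      \<open>q\<close> positive.\<close>
    define q where "q = max (1/2) (1 - \<rho>\<^sup>2 / (norm y)\<^sup>2)"
    have q: "0 < q" "q < 1" using \<rho>(1) y by (auto simp: q_def)
    have near: "h z < - \<epsilon>" if "cos2 y z > q" for z
    proof -
      have t: "cos2 y z > 0" using that q by simp
      then have z: "z \<noteq> 0" by (auto simp: cos2_def hcos_def)
      define c where "c = herm y z / (norm z)\<^sup>2"
      have c: "c \<noteq> 0" using t z by (auto simp: c_def cos2_eq)
      have "(norm (y - c *s z))\<^sup>2 = (norm y)\<^sup>2 * (1 - cos2 y z)"
        unfolding c_def norm_sub_projection[OF z] using y z by (simp add: cos2_eq field_simps)
      also have "\<dots> < (norm y)\<^sup>2 * (\<rho>\<^sup>2 / (norm y)\<^sup>2)"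
        using that y by (intro mult_strict_left_mono) (auto simp: q_def)
      also have "\<dots> = \<rho>\<^sup>2" using y by simp
      finally have "norm (y - c *s z) < \<rho>" using \<rho>(1) by (auto intro: power2_less_imp_less)
      then have "h (c *s z) < - \<epsilon>" by (intro \<rho>(2)) (simp add: dist_norm norm_minus_commute)
      then show ?thesis by (simp add: h_def g_scale[OF c])
    qed
    have ih: "integrable fs_measure h"
      unfolding h_def[abs_def] using integrable_g[OF x] by simp
    have it: "integrable fs_measure (\<lambda>z. cos2 y z ^ N)" for N
      by (rule fs.integrable_const_bound[of _ 1]) (auto simp: power_le_one)
    define H where "H = (\<integral>z. \<bar>h z\<bar> \<partial>fs_measure)"
    \<comment> \<open>The kernel mean of \<open>h\<close> is nonnegative. Near \<open>y\<close> the
      function is below \<open>- \<epsilon>\<close>, and elsewhere the kernel is at most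
      \<open>q ^ N\<close> times its normalizing binomial.\<close>
    have main: "\<epsilon> \<le> real ((d + N) choose N) * q ^ N * (H + \<epsilon>)" for N
    proof -
      define C where "C = real ((d + N) choose N)"
      have C: "C > 0" unfolding C_def by (simp add: zero_less_binomial)
      have m: "(\<integral>z. cos2 y z ^ N \<partial>fs_measure) = 1 / C"
        using fs_moment_eq[OF y, of d N] card by (simp add: C_def fs_moment_def)
      have ihp: "integrable fs_measure (\<lambda>z. h z * cos2 y z ^ N)"
        by (rule integrable_mult_bounded[OF ih, where B = 1]) (auto simp: power_le_one)
      have "FS_volume TYPE('n) * C * (\<integral>z. h z * cos2 y z ^ N \<partial>fs_measure)
          = FS_volume TYPE('n) * C * ((\<integral>z. g x z * cos2 y z ^ N \<partial>fs_measure) + 1 / (4 * FS_volume TYPE('n)) * (\<integral>z. cos2 y z ^ N \<partial>fs_measure))"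
        using integrable_g_cos2[OF x, of y N] it[of N] by (simp add: h_def algebra_simps)
      also have "\<dots> = FS_volume TYPE('n) * (\<integral>z. g x z * cos2 y z ^ N \<partial>fs_measure) * C + 1 / 4"
        unfolding m using V_pos C by (simp add: field_simps)
      also have "\<dots> = green_mean d N (cos2 y x) + 1 / 4"
        using integral_g_cos2[OF x y, of N] unfolding C_def by simp
      also have "\<dots> \<ge> 0" using green_mean_ge[OF d, of "cos2 y x" N] by simp
      finally have "FS_volume TYPE('n) * C * 0 \<le> FS_volume TYPE('n) * C * (\<integral>z. h z * cos2 y z ^ N \<partial>fs_measure)"
        by simp
      then have "0 \<le> (\<integral>z. h z * cos2 y z ^ N \<partial>fs_measure)"
        by (rule mult_left_le_imp_le) (use V_pos C in simp)
      also have "\<dots> \<le> (\<integral>z. \<bar>h z\<bar> * q ^ N - \<epsilon> * (cos2 y z ^ N - q ^ N) \<partial>fs_measure)"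
      proof (rule integral_mono)
        show "integrable fs_measure (\<lambda>z. \<bar>h z\<bar> * q ^ N - \<epsilon> * (cos2 y z ^ N - q ^ N))"
          using ih it[of N] by simp
        show "h z * cos2 y z ^ N \<le> \<bar>h z\<bar> * q ^ N - \<epsilon> * (cos2 y z ^ N - q ^ N)" for z
        proof (cases "cos2 y z > q")
          case True
          have "h z * cos2 y z ^ N \<le> - \<epsilon> * cos2 y z ^ N"
            using near[OF True] by (intro mult_right_mono) auto
          also have "\<dots> \<le> \<bar>h z\<bar> * q ^ N - \<epsilon> * (cos2 y z ^ N - q ^ N)"
            using \<epsilon> q by (simp add: algebra_simps)
          finally show ?thesis .
        next
          case False
          then have le: "cos2 y z ^ N \<le> q ^ N" by (intro power_mono) auto
          have "h z * cos2 y z ^ N \<le> \<bar>h z\<bar> * q ^ N"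
            using le by (intro mult_mono) auto
          moreover have "\<epsilon> * (cos2 y z ^ N - q ^ N) \<le> 0"
            using le \<epsilon> by (simp add: mult_nonneg_nonpos)
          ultimately show ?thesis by simp
        qed
      qed (rule ihp)
      also have "\<dots> = H * q ^ N - \<epsilon> * (1 / C - q ^ N)"
        using ih it[of N] m by (simp add: H_def)
      finally show ?thesis
        using C unfolding C_def[symmetric] by (simp add: field_simps)
    qed
    \<comment> \<open>The normalizing binomial grows polynomially in \<open>N\<close>, so the
      exponential decay of \<open>q ^ N\<close> wins and forces
      \<open>\<epsilon> \<le> 0\<close>.\<close>
    have "(\<lambda>N. (real d + real N) ^ d * q ^ N) \<longlonglongrightarrow> 0"
      using q by real_asymp
    then have "(\<lambda>N. (real d + real N) ^ d * q ^ N * (H + \<epsilon>)) \<longlonglongrightarrow> 0 * (H + \<epsilon>)"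
      by (intro tendsto_mult tendsto_const)
    moreover have "\<epsilon> \<le> (real d + real N) ^ d * q ^ N * (H + \<epsilon>)" for N
    proof -
      have "H \<ge> 0" by (simp add: H_def)
      have "(d + N) choose N \<le> (d + N) ^ d"
        using binomial_le_pow[of d "d + N"] binomial_symmetric[of N "d + N"] by simp
      then have "real ((d + N) choose N) \<le> (real d + real N) ^ d"
        by (metis of_nat_add of_nat_le_iff of_nat_power)
      then have "real ((d + N) choose N) * q ^ N * (H + \<epsilon>) \<le> (real d + real N) ^ d * q ^ N * (H + \<epsilon>)"
        using q \<open>H \<ge> 0\<close> \<epsilon> by (intro mult_right_mono) auto
      with main[of N] show ?thesis by linarith
    qed
    ultimately have "\<epsilon> \<le> 0 * (H + \<epsilon>)"
      by (intro LIMSEQ_le_const) auto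
    then show False using \<epsilon> by simp
  qed
qed

lemma integrable_g_pair: "integrable (fs_measure \<Otimes>\<^sub>M fs_measure) (\<lambda>(x, z). g x z)"
proof -
  interpret P: pair_prob_space "fs_measure :: (complex^'n) measure" "fs_measure :: (complex^'n) measure" ..
  have [measurable]: "(\<lambda>(x, y). g x y) \<in> borel_measurable (fs_measure \<Otimes>\<^sub>M fs_measure)"
    using measurable_g by measurable
  have i: "integrable fs_measure (g x)" for x
  proof (cases "x = 0")
    case True
    then have "g x = (\<lambda>_. 0)" by (simp add: g_def fun_eq_iff)
    then show ?thesis by simp
  qed (rule integrable_g)
  have n: "(\<integral>z. \<bar>g x z\<bar> \<partial>fs_measure) \<le> 1 / (2 * FS_volume TYPE('n))" for x
  proof (cases "x = 0")
    case True
    then have "g x = (\<lambda>_. 0)" by (simp add: g_def fun_eq_iff)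
    then show ?thesis using V_pos by simp
  next
    case False
    have "(\<integral>z. \<bar>g x z\<bar> \<partial>fs_measure) \<le> (\<integral>z. g x z + 1 / (2 * FS_volume TYPE('n)) \<partial>fs_measure)"
    proof (rule integral_mono)
      \<comment> \<open>The lower bound \<open>-1 / (4 V)\<close>, with V the volume, controls the
        negative part, and adding it twice bounds the absolute value; as \<open>g x\<close> has mean
        zero, its L^1 norm is bounded uniformly in \<open>x\<close>.\<close>
      show "\<bar>g x z\<bar> \<le> g x z + 1 / (2 * FS_volume TYPE('n))" for z
        using g_lower_bound[of x z] V_pos by (auto simp: abs_if field_simps)
    qed (use i in auto)
    also have "\<dots> = 1 / (2 * FS_volume TYPE('n))" using i integral_g[OF False] by simp
    finally show ?thesis .
  qed
  show ?thesis
  proof (rule P.Fubini_integrable)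
    show "integrable fs_measure (\<lambda>x. \<integral>y. norm (case (x, y) of (x, y) \<Rightarrow> g x y) \<partial>fs_measure)"
      by (rule fs.integrable_const_bound[of _ "1 / (2 * FS_volume TYPE('n))"]) (use n in auto)
  qed (use i in auto)
qed

lemma projection_kernel_hcos:
  assumes L: "L \<ge> 1"
  shows "projection_kernel fs_measure ((d + L) choose L)
    (\<lambda>x z :: complex^'n. of_nat ((d + L) choose L) * hcos x z ^ L)"
  unfolding projection_kernel_def
proof (intro conjI allI ballI)
  let ?C = "(d + L) choose L"
  have C: "?C > 0" by (simp add: zero_less_binomial)
  show "(\<lambda>(x, y). of_nat ?C * hcos x y ^ L) \<in> borel_measurable (fs_measure \<Otimes>\<^sub>M (fs_measure :: (complex^'n) measure))"
    by measurable
  have "cmod (of_nat ?C * hcos x y ^ L) \<le> real ?C" for x y :: "complex^'n"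
    using cmod_hcos_le_1[of x y] by (simp add: norm_mult norm_power power_le_one mult_left_le)
  then show "\<exists>B. \<forall>x y :: complex^'n. cmod (of_nat ?C * hcos x y ^ L) \<le> B" by blast
  show "of_nat ?C * hcos y x ^ L = cnj (of_nat ?C * hcos x y ^ L)" for x y :: "complex^'n"
    using hcos_cnj[of x y] by simp
  show "(\<integral>y. of_nat ?C * hcos x y ^ L * (of_nat ?C * hcos y z ^ L) \<partial>fs_measure) = of_nat ?C * hcos x z ^ L"
    for x z :: "complex^'n"
  proof (cases "x = 0")
    \<comment> \<open>The reproducing identity is also demanded at the origin, where
      \<open>L \<ge> 1\<close> makes both sides vanish.\<close>
    case True
    then show ?thesis using L by (simp add: hcos_def power_0_left)
  next
    case False
    have "(\<integral>y. of_nat ?C * hcos x y ^ L * (of_nat ?C * hcos y z ^ L) \<partial>fs_measure)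
        = (\<integral>y. (of_nat ?C * of_nat ?C) * (hcos x y ^ L * hcos y z ^ L) \<partial>fs_measure)"
      by (simp add: mult_ac)
    also have "\<dots> = (of_nat ?C * of_nat ?C) * (of_real (1 / real ?C) * hcos x z ^ L)"
      using fs_moment_eq[OF False, of d L] card
      by (simp only: Bochner_Integration.integral_mult_right_zero integral_hcos_power[OF False])
    also have "\<dots> = of_nat ?C * hcos x z ^ L" using C by simp
    finally show ?thesis .
  qed
  have "(\<integral>(x::complex^'n). Re (of_nat ?C * hcos x x ^ L) \<partial>fs_measure) = (\<integral>(x::complex^'n). real ?C \<partial>fs_measure)"
    using AE_fs_measure_nonzero
    by (intro integral_cong_AE) (auto simp: hcos_self elim: eventually_mono)
  then show "(\<integral>(x::complex^'n). Re (of_nat ?C * hcos x x ^ L) \<partial>fs_measure) = real ?C"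
    by simp
qed

lemma green_energy_eq:
  assumes "\<And>i. i < r \<Longrightarrow> y i \<noteq> 0" "\<And>i j. i < j \<Longrightarrow> j < r \<Longrightarrow> \<not> proj_eq (y i) (y j)"
  shows "green_energy G r y = ereal (\<Sum>i<r. \<Sum>j<r. if i = j then 0 else g (y i) (y j))"
proof -
  have "(if i = j then 0 else G (y i) (y j)) = ereal (if i = j then 0 else g (y i) (y j))"
    if "i < r" "j < r" for i j
  proof (cases "i = j")
    case False
    then have "\<not> proj_eq (y i) (y j)"
      using assms that proj_eq_commute by (metis linorder_neqE_nat)
    then show ?thesis
      using assms(1) that False G_finite[of "y i" "y j"] by (simp add: g_def ereal_real)
  qed simp
  then show ?thesis unfolding green_energy_def by simp
qed

text \<open>The mean bound is applied without a field. In the two-point density the constant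
  \<open>r\<^sup>2\<close> integrates to 0 against \<open>g x\<close>, and the remaining term is a
  kernel mean centred at \<open>x\<close> itself, hence \<open>green_mean\<close> at 1.\<close>

lemma min_green_energy_le:
  assumes L: "L \<ge> 1"
  defines "r \<equiv> (d + L) choose L"
  shows "min_green_energy G r \<le> ereal (- (real r / FS_volume TYPE('n)) * green_mean d L 1)"
proof -
  interpret P: pair_prob_space "fs_measure :: (complex^'n) measure" "fs_measure :: (complex^'n) measure" ..
  define K where "K = (\<lambda>x z :: complex^'n. of_nat r * hcos x z ^ L)"
  have K: "projection_kernel fs_measure r K"
    unfolding K_def r_def by (rule projection_kernel_hcos[OF L])
  obtain B where B: "\<And>x z. \<bar>corr2 K x z\<bar> \<le> B" and "\<And>y x z. \<bar>corr3 K y x z\<bar> \<le> B"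
    by (rule fs.corr2_bounded[OF K]) (rule that)
  note [measurable (raw)] = fs.projection_kernel_measurable[OF K]
  have m2[measurable]: "(\<lambda>(x, z). corr2 K x z) \<in> borel_measurable (fs_measure \<Otimes>\<^sub>M fs_measure)"
    unfolding corr2_def by measurable
  have c2: "corr2 K x z = (real r)\<^sup>2 - (real r)\<^sup>2 * cos2 x z ^ L" if "x \<noteq> 0" "z \<noteq> 0" for x z
    using that by (simp add: corr2_def K_def hcos_self norm_mult norm_power cos2_def power_mult_distrib power2_eq_square)
  define I where "I = (\<integral>p. g (fst p) (snd p) * corr2 K (fst p) (snd p) \<partial>(fs_measure \<Otimes>\<^sub>M fs_measure))"
  have "I = (\<integral>x. (\<integral>z. g x z * corr2 K x z \<partial>fs_measure) \<partial>fs_measure)"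
  proof -
    have "integrable (fs_measure \<Otimes>\<^sub>M fs_measure) (\<lambda>p. g (fst p) (snd p) * corr2 K (fst p) (snd p))"
      by (rule integrable_mult_bounded[where B = B])
         (use integrable_g_pair m2 B in \<open>auto simp: split_beta'\<close>)
    from P.integral_fst'[OF this] show ?thesis by (simp add: I_def)
  qed
  also have "\<dots> = (\<integral>(x::complex^'n). - (real r / FS_volume TYPE('n)) * green_mean d L 1 \<partial>fs_measure)"
  proof (rule integral_cong_AE)
    have inner: "(\<integral>z. g x z * corr2 K x z \<partial>fs_measure) = - (real r / FS_volume TYPE('n)) * green_mean d L 1" if x: "x \<noteq> 0" for x
    proof -
      have [measurable]: "corr2 K x \<in> borel_measurable borel"
        using measurable_compose[OF measurable_Pair1'[of x fs_measure fs_measure] m2] by simp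
      have "(\<integral>z. g x z * corr2 K x z \<partial>fs_measure)
          = (\<integral>z. (real r)\<^sup>2 * g x z - (real r)\<^sup>2 * (g x z * cos2 x z ^ L) \<partial>fs_measure)"
        using AE_fs_measure_nonzero
        by (intro integral_cong_AE) (auto elim!: eventually_mono simp: c2[OF x] algebra_simps)
      also have "\<dots> = - (real r)\<^sup>2 * (\<integral>z. g x z * cos2 x z ^ L \<partial>fs_measure)"
        using integrable_g[OF x] integral_g[OF x] integrable_g_cos2[OF x, of x L] by simp
      also have "\<dots> = - (real r / FS_volume TYPE('n)) * (FS_volume TYPE('n) * (\<integral>z. g x z * cos2 x z ^ L \<partial>fs_measure) * real r)"
        using V_pos by (simp add: power2_eq_square field_simps)
      also have "\<dots> = - (real r / FS_volume TYPE('n)) * green_mean d L 1"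
        using integral_g_cos2[OF x x, of L] x by (simp add: cos2_self r_def)
      finally show ?thesis .
    qed
    then show "AE x in fs_measure. (\<integral>z. g x z * corr2 K x z \<partial>fs_measure) = - (real r / FS_volume TYPE('n)) * green_mean d L 1"
      using AE_fs_measure_nonzero by (auto elim: eventually_mono)
    have [measurable]: "(\<lambda>(x, y). g x y) \<in> borel_measurable (fs_measure \<Otimes>\<^sub>M fs_measure)"
      using measurable_g by measurable
    show "(\<lambda>x. \<integral>z. g x z * corr2 K x z \<partial>fs_measure) \<in> borel_measurable fs_measure" by measurable
  qed simp
  also have "\<dots> = - (real r / FS_volume TYPE('n)) * green_mean d L 1"
    by simp
  finally have I: "I = - (real r / FS_volume TYPE('n)) * green_mean d L 1" .
  have le: "m \<le> I" if m: "ereal m \<le> min_green_energy G r" for m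
  proof -
    have "m \<le> (\<integral>x. 0 * Re (K x x) \<partial>fs_measure) + I"
      unfolding I_def
    proof (rule fs.determinantal_mean_bound[where good = "\<lambda>x z. x = 0 \<or> \<not> proj_eq x z" and A = "- {0}",
          OF integrable_g_pair g_commute _ K])
      \<comment> \<open>The condition must hold for every \<open>x\<close>; the disjunct
        \<open>x = 0\<close> covers the origin, and \<open>A\<close> removes it from the
        configurations.\<close>
      show "AE z in fs_measure. x = 0 \<or> \<not> proj_eq x z" for x :: "complex^'n"
        using AE_not_proj_eq[of x] card d by (cases "x = 0") auto
      show "AE x in fs_measure. x \<in> - {0 :: complex^'n}"
        using AE_fs_measure_nonzero by simp
      fix y :: "nat \<Rightarrow> complex^'n"
      assume y: "\<And>i. i < r \<Longrightarrow> y i \<in> - {0}"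
        "\<And>i j. i < j \<Longrightarrow> j < r \<Longrightarrow> y i = 0 \<or> \<not> proj_eq (y i) (y j)"
      have "ereal m \<le> green_energy G r y"
        using m unfolding min_green_energy_def by (rule order_trans) (rule INF_lower, use y(1) in auto)
      also have "\<dots> = ereal (\<Sum>i<r. \<Sum>j<r. if i = j then 0 else g (y i) (y j))"
        by (rule green_energy_eq) (use y in force)+
      finally show "m \<le> (\<Sum>i<r. 0) + (\<Sum>i<r. \<Sum>j<r. if i = j then 0 else g (y i) (y j))" by simp
    qed simp
    then show ?thesis by simp
  qed
  \<comment> \<open>The minimum is an extended real, possibly infinite, whereas the mean bound
    concerns real \<open>m\<close>; a real number strictly between \<open>I\<close> and the minimum
    bridges the two.\<close>
  have "min_green_energy G r \<le> ereal I"
  proof (rule ccontr)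
    assume "\<not> ?thesis"
    then obtain m where "ereal I < ereal m" "ereal m < min_green_energy G r"
      using ereal_dense2[of "ereal I" "min_green_energy G r"] by (auto simp: not_le)
    then show False using le[of m] by (simp add: less_imp_le)
  qed
  then show ?thesis unfolding I .
qed

end

section \<open>Asymptotics\<close>

lemma binomial_times_fact_Suc:
  "real ((Suc e + j) choose j) * fact (Suc e) = real ((e + j) choose j) * fact e * (real j + real (Suc e))"
proof -
  have "Suc e * ((Suc e + j) choose j) = (Suc e + j) * ((e + j) choose j)"
    using binomial_absorb_comp[of "Suc e + j" j] by simp
  then have "real (Suc e) * real ((Suc e + j) choose j) = (real j + real (Suc e)) * real ((e + j) choose j)"
    by (simp only: flip: of_nat_mult of_nat_add) (simp add: add.commute)
  then have "(real (Suc e) * real ((Suc e + j) choose j)) * fact e = ((real j + real (Suc e)) * real ((e + j) choose j)) * fact e"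
    by (rule arg_cong)
  then show ?thesis
    by (simp only: fact_Suc mult_ac)
qed

text \<open>The middle quantity is the product (j + 1) ... (j + e).\<close>

lemma binomial_times_fact_bounds:
  "real j ^ e \<le> real ((e + j) choose j) * fact e \<and> real ((e + j) choose j) * fact e \<le> (real j + real e) ^ e"
proof (induction e)
  case (Suc e)
  have "real j ^ Suc e \<le> real j ^ e * (real j + real (Suc e))"
    by (simp add: mult_right_mono algebra_simps)
  also have "\<dots> \<le> real ((e + j) choose j) * fact e * (real j + real (Suc e))"
    using Suc.IH by (intro mult_right_mono) auto
  finally have "real j ^ Suc e \<le> real ((Suc e + j) choose j) * fact (Suc e)"
    unfolding binomial_times_fact_Suc .
  moreover have "real ((Suc e + j) choose j) * fact (Suc e) \<le> (real j + real e) ^ e * (real j + real (Suc e))"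
    unfolding binomial_times_fact_Suc using Suc.IH by (intro mult_right_mono) auto
  moreover have "(real j + real e) ^ e * (real j + real (Suc e)) \<le> (real j + real (Suc e)) ^ Suc e"
    unfolding power_Suc2 by (intro mult_right_mono power_mono) auto
  ultimately show ?case by linarith
qed simp

text \<open>The mean value estimate for a power; it allows a power sum to be bounded below by
  telescoping.\<close>

lemma power_Suc_diff_le:
  fixes x :: real
  assumes "x \<ge> 0"
  shows "(x + 1) ^ Suc m - x ^ Suc m \<le> real (Suc m) * (x + 1) ^ m"
proof (induction m)
  case (Suc m)
  have "(x + 1) ^ Suc (Suc m) - x ^ Suc (Suc m) = (x + 1) * ((x + 1) ^ Suc m - x ^ Suc m) + x ^ Suc m"
    by (simp add: algebra_simps)
  also have "\<dots> \<le> (x + 1) * (real (Suc m) * (x + 1) ^ m) + (x + 1) ^ Suc m"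
    using assms by (intro add_mono mult_left_mono Suc.IH power_mono) auto
  also have "\<dots> = real (Suc (Suc m)) * (x + 1) ^ Suc m"
    by (simp add: algebra_simps)
  finally show ?case .
qed simp

text \<open>The terms with -1 form \<open>green_mean d L 0\<close>, bounded by
  \<open>green_mean_ge\<close>. In the others the factor \<open>j + d\<close> of the binomial
  cancels against the denominator, leaving at least j^m / (4 d!) with m = d - 2, and these sum to
  order L^(d-1).\<close>

lemma green_mean_at_1_ge:
  assumes "d = Suc (Suc m)"
  shows "real L ^ Suc m / (4 * real (Suc m) * fact d) - 1 / 4 \<le> green_mean d L 1"
proof -
  have "green_mean d L 1 = (\<Sum>j=1..L. real ((d + j) choose j) / (4 * real j * real (j + d))) + green_mean d L 0"
    unfolding green_mean_def sum.distrib[symmetric]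
    by (rule sum.cong) (auto simp: diff_divide_distrib power_0_left)
  moreover have "real L ^ Suc m / (4 * real (Suc m) * fact d) \<le> (\<Sum>j=1..L. real ((d + j) choose j) / (4 * real j * real (j + d)))"
  proof (induction L)
    case (Suc L)
    define j where "j = Suc L"
    have j: "real j = real L + 1" "j > 0" by (simp_all add: j_def)
    have "real j ^ Suc m - real L ^ Suc m \<le> real (Suc m) * real j ^ m"
      unfolding j(1) by (rule power_Suc_diff_le) simp
    then have "(real j ^ Suc m - real L ^ Suc m) / (4 * real (Suc m) * fact d)
        \<le> (real (Suc m) * real j ^ m) / (4 * real (Suc m) * fact d)"
      by (rule divide_right_mono) simp
    also have "\<dots> = (real j ^ Suc m * (real j + real d)) / (4 * real j * real (j + d) * fact d)"
    proof -
      have "s * p / (4 * s * f) = (J * p * D) / (4 * J * D * f)" if "s \<noteq> 0" "J \<noteq> 0" "D \<noteq> 0" for s p f J D :: real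
        using that by (simp add: field_simps)
      from this[of "real (Suc m)" "real j" "real j + real d" "real j ^ m" "fact d"] show ?thesis
        using j(2) by (simp del: of_nat_Suc)
    qed
    also have "\<dots> \<le> (real ((d + j) choose j) * fact d) / (4 * real j * real (j + d) * fact d)"
    proof (rule divide_right_mono)
      have "real j ^ Suc m * (real j + real d) \<le> real ((Suc m + j) choose j) * fact (Suc m) * (real j + real d)"
        using binomial_times_fact_bounds[of j "Suc m"] by (intro mult_right_mono) auto
      then show "real j ^ Suc m * (real j + real d) \<le> real ((d + j) choose j) * fact d"
        unfolding assms binomial_times_fact_Suc .
    qed simp
    also have "\<dots> = real ((d + j) choose j) / (4 * real j * real (j + d))"
      by simp
    finally have "real j ^ Suc m / (4 * real (Suc m) * fact d)
        \<le> real L ^ Suc m / (4 * real (Suc m) * fact d) + real ((d + j) choose j) / (4 * real j * real (j + d))"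
      unfolding diff_divide_distrib by linarith
    also have "\<dots> \<le> (\<Sum>j=1..L. real ((d + j) choose j) / (4 * real j * real (j + d)))
        + real ((d + j) choose j) / (4 * real j * real (j + d))"
      by (rule add_right_mono[OF Suc.IH])
    also have "\<dots> = (\<Sum>j=1..Suc L. real ((d + j) choose j) / (4 * real j * real (j + d)))"
      unfolding j_def by (simp del: binomial_Suc_Suc of_nat_Suc)
    finally show ?case unfolding j_def .
  qed simp
  moreover have "green_mean d L 0 \<ge> - 1 / 4"
    by (rule green_mean_ge) (use assms in auto)
  ultimately show ?thesis by linarith
qed

lemma strict_mono_binomial_add:
  assumes "d \<ge> 1"
  shows "strict_mono (\<lambda>L. (d + L) choose L)"
proof (rule strict_monoI_Suc)
  fix L
  have "(d + Suc L) choose Suc L = ((d + L) choose L) + ((d + L) choose Suc L)" by simp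
  moreover have "(d + L) choose Suc L > 0" using assms by (intro zero_less_binomial) simp
  ultimately show "(d + L) choose L < (d + Suc L) choose Suc L" by linarith
qed

theorem theorem1p3:
  fixes G :: "complex^'n \<Rightarrow> complex^'n \<Rightarrow> ereal" and d :: nat
  assumes "CARD('n) = d + 1" and "d \<ge> 2" and "is_FS_green G"
  shows "liminf (\<lambda>r. min_green_energy G r / ereal (real r powr (2 - 1 / real d)))
           \<le> ereal (- (fact d powr (1 - 1 / real d)) / (4 * pi ^ d * (real d - 1)))"
proof -
  interpret fs_green G d using assms by unfold_locales auto
  obtain m where m: "d = Suc (Suc m)" using assms(2) by (metis add_2_eq_Suc le_Suc_ex)
  define V where "V = FS_volume TYPE('n)"
  have V: "V = pi ^ d / fact d" using assms(1) by (simp add: V_def FS_volume_def)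
  have V_pos: "V > 0" by (simp add: V)
  \<comment> \<open>Point numbers of the projective ensembles. They increase strictly, so bounding
    the energy along this subsequence bounds the lower limit.\<close>
  define r where "r L = (d + L) choose L" for L
  have r_pos: "real (r L) > 0" for L unfolding r_def of_nat_0_less_iff by (intro zero_less_binomial) simp
  define a where "a L = real L ^ Suc m / (4 * real (Suc m) * fact d) - 1 / 4" for L
  define F :: real where "F = fact d powr (1 - 1 / real d)"
  define b where "b L = - (1 / V) * (F * (a L / (real L + real d) ^ Suc m))" for L
  have "(\<lambda>L. real L / (real L + real d)) \<longlonglongrightarrow> 1" "(\<lambda>L. 1 / (real L + real d)) \<longlonglongrightarrow> 0"
    by real_asymp+
  then have "(\<lambda>L. (real L / (real L + real d)) ^ Suc m / (4 * real (Suc m) * fact d) - 1 / 4 * (1 / (real L + real d)) ^ Suc m)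
      \<longlonglongrightarrow> 1 ^ Suc m / (4 * real (Suc m) * fact d) - 1 / 4 * 0 ^ Suc m"
    by (intro tendsto_intros) simp_all
  then have a_lim: "(\<lambda>L. a L / (real L + real d) ^ Suc m) \<longlonglongrightarrow> 1 / (4 * real (Suc m) * fact d)"
    by (simp add: a_def power_divide diff_divide_distrib mult.commute)
  have "b \<longlonglongrightarrow> - (1 / V) * (F * (1 / (4 * real (Suc m) * fact d)))"
    unfolding b_def by (intro tendsto_intros a_lim)
  also have "- (1 / V) * (F * (1 / (4 * real (Suc m) * fact d))) = - F / (4 * pi ^ d * (real d - 1))"
    unfolding V m by simp
  finally have b_lim: "b \<longlonglongrightarrow> - F / (4 * pi ^ d * (real d - 1))" .
  \<comment> \<open>Positivity is needed because the denominator will be replaced by a larger one,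
    which lowers the quotient only for a positive numerator.\<close>
  have a_pos: "eventually (\<lambda>L. a L / (real L + real d) ^ Suc m > 0) sequentially"
    by (rule order_tendstoD(1)[OF a_lim]) simp
  \<comment> \<open>From \<open>r L\<close> at most (L + d)^d / d!; the power 1 - 1/d turns d! into
    \<open>F\<close>, the numerator of the final constant.\<close>
  have r_le: "real (r L) powr (1 - 1 / real d) \<le> (real L + real d) ^ Suc m / F" for L
  proof -
    have "real (r L) \<le> (real L + real d) ^ d / fact d"
      using binomial_times_fact_bounds[of L d] unfolding r_def by (simp add: field_simps)
    then have "real (r L) powr (1 - 1 / real d) \<le> ((real L + real d) ^ d / fact d) powr (1 - 1 / real d)"
      using m by (intro powr_mono2) auto
    also have "\<dots> = ((real L + real d) ^ d) powr (1 - 1 / real d) / F"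
      unfolding F_def by (rule powr_divide)
    also have "((real L + real d) ^ d) powr (1 - 1 / real d) = (real L + real d) powr (real d * (1 - 1 / real d))"
    proof -
      have "0 < real L + real d" using m by simp
      then show ?thesis by (subst powr_realpow[symmetric]) (simp_all only: powr_powr)
    qed
    also have "real d * (1 - 1 / real d) = real (Suc m)"
      unfolding m by (simp add: field_simps)
    also have "(real L + real d) powr real (Suc m) = (real L + real d) ^ Suc m"
      using m by (intro powr_realpow) simp
    finally show ?thesis .
  qed
  have bound: "min_green_energy G (r L) / ereal (real (r L) powr (2 - 1 / real d)) \<le> ereal (b L)"
    if L: "L \<ge> 1" and aL: "a L / (real L + real d) ^ Suc m > 0" for L
  proof -
    define \<rho> where "\<rho> = real (r L) powr (1 - 1 / real d)"
    have \<rho>: "\<rho> > 0" "real (r L) powr (2 - 1 / real d) = real (r L) * \<rho>"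
      using r_pos[of L] powr_mult_base[of "real (r L)" "1 - 1 / real d"] by (simp_all add: \<rho>_def)
    have Ld: "(real L + real d) ^ Suc m > 0" using m by simp
    have F: "F > 0" by (simp add: F_def)
    have "min_green_energy G (r L) / ereal (real (r L) * \<rho>)
        \<le> ereal (- (real (r L) / V) * green_mean d L 1) / ereal (real (r L) * \<rho>)"
      using min_green_energy_le[OF L] \<rho> r_pos[of L] unfolding r_def V_def
      by (intro ereal_divide_right_mono) auto
    also have "\<dots> = ereal (- (1 / V) * (green_mean d L 1 / \<rho>))"
      using r_pos[of L] \<rho>(1) V_pos by simp
    also have "\<dots> \<le> ereal (b L)"
    proof -
      have "F * (a L / (real L + real d) ^ Suc m) = a L / ((real L + real d) ^ Suc m / F)"
        by simp
      also have "\<dots> \<le> a L / \<rho>"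
        using r_le[of L] \<rho>(1) aL Ld F unfolding \<rho>_def[symmetric]
        by (intro divide_left_mono mult_pos_pos divide_pos_pos) (auto simp: zero_less_divide_iff)
      also have "\<dots> \<le> green_mean d L 1 / \<rho>"
        using green_mean_at_1_ge[OF m, of L] \<rho>(1) unfolding a_def by (intro divide_right_mono) auto
      finally have "F * (a L / (real L + real d) ^ Suc m) \<le> green_mean d L 1 / \<rho>" .
      then have "1 / V * (F * (a L / (real L + real d) ^ Suc m)) \<le> 1 / V * (green_mean d L 1 / \<rho>)"
        using V_pos by (intro mult_left_mono) auto
      then show ?thesis
        unfolding b_def ereal_less_eq mult_minus_left neg_le_iff_le .
    qed
    finally show ?thesis unfolding \<rho>(2) .
  qed
  let ?X = "\<lambda>r. min_green_energy G r / ereal (real r powr (2 - 1 / real d))"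
  have "liminf ?X \<le> liminf (?X \<circ> r)"
    unfolding r_def using assms(2) by (intro liminf_subseq_mono strict_mono_binomial_add) simp
  also have "\<dots> \<le> liminf (\<lambda>L. ereal (b L))"
  proof (rule Liminf_mono)
    show "eventually (\<lambda>L. (?X \<circ> r) L \<le> ereal (b L)) sequentially"
      using a_pos eventually_ge_at_top[of 1]
      by eventually_elim (use bound in simp)
  qed
  also have "\<dots> = ereal (- F / (4 * pi ^ d * (real d - 1)))"
    using b_lim by (intro lim_imp_Liminf) auto
  finally show ?thesis unfolding F_def .
qed

end
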